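(* Let $\rho>0$, let $H$ be regularly varying at $0$ with index $-\rho$, and let $(A,B)$ be a pair of nonnegative random variables with $\mathbb{E}[\log A]<0$ and $\mathbb{E}[\log^+B]<\infty$. Suppose that $g$ is the $(\rho,H)$-local dependence measure of $(A,B)$, that $g(0)>0$, and that $$\lambda^\ast=\inf_{y>1}\left\{\frac{y^\rho}{y^\rho-1}\,g(y)\right\}\in(0,\infty).$$ Let $(A_n,B_n)_{n\ge1}$ be i.i.d. copies of $(A,B)$, let $X_0=0$ and $X_n=A_nX_{n-1}+B_n$ for $n\ge1$. Then, almost surely, $$\liminf_{n\to\infty}\frac{X_n}{H^{-1}(\log n)}=(\lambda^\ast)^{1/\rho}.$$
   Context: A function $H:(0,\infty)\to(0,\infty)$ is regularly varying at $0$ with index $-\rho$ if $\lim_{x\to0^+}H(tx)/H(x)=t^{-\rho}$ for all $t>0$; by convention every such $H$ is taken continuous and nonincreasing, and $H^{-1}$ denotes its (generalized) inverse, defined for large arguments and regularly varying at $\infty$ with index $-1/\rho$. A function $g:[0,\infty)\to[0,\infty]$ is the $(\rho,H)$-local dependence measure of a pair $(A,B)$ of nonnegative random variables if for every $y\ge 0$ the following limit exists and $$g(y)=\lim_{\varepsilon\to0^+}\frac{-\log\mathbb{P}(\varepsilon Ay+B<\varepsilon)}{H(\varepsilon)}.$$ Convention: $-\log 0=\infty$. *)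

theory Defs
  imports "HOL-Probability.Probability"
begin

text \<open>The logarithm on \<open>[0, \<infinity>)\<close> with \<open>log 0 = -\<infinity>\<close>; the library has \<open>ln 0 = 0\<close>.\<close>

definition elog :: "real \<Rightarrow> ereal" where
  "elog x = (if x \<le> 0 then - \<infinity> else ereal (ln x))"

text \<open>
  Expectation with values in \<open>[-\<infinity>, \<infinity>]\<close>, as the difference of the integrals of the positive and
  the negative part (\<^const>\<open>e2ennreal\<close> sends negative numbers to 0). In the undefined case the
  library's \<open>\<infinity> - \<infinity> = \<infinity>\<close> applies, so that any hypothesis \<open>ext_expectation M f < c\<close> entails that
  the expectation is well defined; it may be \<open>-\<infinity>\<close>.
\<close>

definition ext_expectation :: "'a measure \<Rightarrow> ('a \<Rightarrow> ereal) \<Rightarrow> ereal" where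
  "ext_expectation M f =
     enn2ereal (\<integral>\<^sup>+ \<omega>. e2ennreal (f \<omega>) \<partial>M) - enn2ereal (\<integral>\<^sup>+ \<omega>. e2ennreal (- f \<omega>) \<partial>M)"

text \<open>
  Regular variation at 0 with index \<open>-\<rho>\<close> for functions \<open>(0, \<infinity>) \<rightarrow> (0, \<infinity>)\<close>, including the
  convention that such functions are continuous and nonincreasing. Values of \<open>H\<close> outside
  \<open>(0, \<infinity>)\<close> are irrelevant.
\<close>

definition regularly_varying_at_0 :: "real \<Rightarrow> (real \<Rightarrow> real) \<Rightarrow> bool" where
  "regularly_varying_at_0 \<rho> H \<longleftrightarrow>
     (\<forall>x>0. H x > 0) \<and> continuous_on {0<..} H \<and> antimono_on {0<..} H \<and>
     (\<forall>t>0. ((\<lambda>x. H (t * x) / H x) \<longlongrightarrow> t powr (- \<rho>)) (at_right 0))"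

text \<open>
  The set below is nonempty for all \<open>u \<ge> H 1\<close>, and bounded away from 0 when \<open>H\<close> tends to infinity
  at 0; the values for small \<open>u\<close> are meaningless.
\<close>

definition gen_inverse :: "(real \<Rightarrow> real) \<Rightarrow> real \<Rightarrow> real" where
  "gen_inverse H u = Inf {x. 0 < x \<and> H x \<le> u}"

definition local_dependence_measure ::
  "real \<Rightarrow> (real \<Rightarrow> real) \<Rightarrow> 'a measure \<Rightarrow> ('a \<Rightarrow> real) \<Rightarrow> ('a \<Rightarrow> real) \<Rightarrow> (real \<Rightarrow> ereal) \<Rightarrow> bool" where
  "local_dependence_measure \<rho> H M A B g \<longleftrightarrow>
     regularly_varying_at_0 \<rho> H \<and>
     (\<forall>y\<ge>0. 0 \<le> g y \<and>
        ((\<lambda>\<epsilon>. - elog (measure M {\<omega> \<in> space M. \<epsilon> * A \<omega> * y + B \<omega> < \<epsilon>}) / ereal (H \<epsilon>))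
           \<longlongrightarrow> g y) (at_right 0))"

definition iid_copies ::
  "'b measure \<Rightarrow> (nat \<Rightarrow> 'b \<Rightarrow> real) \<Rightarrow> (nat \<Rightarrow> 'b \<Rightarrow> real) \<Rightarrow>
   'a measure \<Rightarrow> ('a \<Rightarrow> real) \<Rightarrow> ('a \<Rightarrow> real) \<Rightarrow> bool" where
  "iid_copies N As Bs M A B \<longleftrightarrow>
     prob_space.indep_vars N (\<lambda>_. borel) (\<lambda>n \<omega>. (As n \<omega>, Bs n \<omega>)) {1..} \<and>
     (\<forall>n\<ge>1. distr N borel (\<lambda>\<omega>. (As n \<omega>, Bs n \<omega>)) = distr M borel (\<lambda>\<omega>. (A \<omega>, B \<omega>)))"

end

theory Submission
  imports Defs "HOL-Real_Asymp.Real_Asymp"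
begin

text \<open>
  Write \<open>\<psi> e y\<close> for the probability that one step \<open>x \<mapsto> A x + B\<close> takes a value \<open>e y\<close> below \<open>e\<close>;
  it is roughly \<open>exp (- g y * H e)\<close>. To be below a small \<open>e\<close>, the recursion has to come down
  through levels \<open>e y\<^sub>1 y\<^sub>2\<close>, \<open>e y\<^sub>1\<close>, \<open>e\<close>, and since \<open>H (e y)\<close> is about
  \<open>y powr (-\<rho>) * H e\<close>, the total cost is \<open>H e\<close> times
  \<open>g y\<^sub>1 + y\<^sub>1 powr (-\<rho>) * g y\<^sub>2 + \<dots>\<close>. The definition of \<open>lam\<close> says
  \<open>g y \<ge> lam * (1 - y powr (-\<rho>))\<close> for \<open>y > 1\<close>, so that the cost telescopes to at least
  \<open>lam * H e\<close>; and a constant ratio \<open>y\<close> that nearly attains the infimum achieves nearly this cost.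
  Hence the probability of \<open>x n < e\<close> behaves like \<open>exp (- lam * H e)\<close>. At \<open>e = c * h n\<close>, where
  \<open>H (h n) = ln n\<close>, this is \<open>n\<close> to the power \<open>- lam * c powr (-\<rho>)\<close>, and the exponent passes \<open>-1\<close>
  at \<open>c powr \<rho> = lam\<close>.

  The lower bound for the limit inferior is the first Borel-Cantelli lemma. The tail estimate is
  obtained by bootstrapping: \<open>lower_tail_rate_step\<close> improves a rate \<open>l\<close> to
  \<open>gam + l * (1 - gam / lam)\<close> with a constant \<open>0 < gam \<le> g 0\<close>. This affine map contracts towards
  its fixed point \<open>lam\<close>, so finitely many steps reach every rate below \<open>lam\<close>. This is where
  \<open>g 0 > 0\<close> enters.

  For the upper bound, call a descent a run of steps that leads from a fixed level \<open>d\<close> below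
  \<open>e = c * h (2 * L)\<close> in constant ratio. It has \<open>O (ln L)\<close> steps, so that between the times \<open>L\<close> and
  \<open>2 * L\<close> there is room for almost \<open>L\<close> independent attempts; if \<open>c powr \<rho> > lam\<close>, one of them
  succeeds with probability at least \<open>1/2\<close>. An attempt is useful only if the recursion is below \<open>d\<close>
  when it starts. That this has a probability bounded away from 0, whatever happened in the distant
  past, is the content of \<open>negative_drift_hits_below\<close> and \<open>hits_below_small\<close>; it rests on the
  negative drift of \<open>ln A\<close>. Conditioning on the last successful descent (\<open>prob_some_success\<close>) gives
  a lower bound for the probability of a small value after any past event, and
  \<open>AE_infinitely_often\<close> turns this bound into certainty.
\<close>

section \<open>Regular variation at zero\<close>

lemma rv_pos: "regularly_varying_at_0 \<rho> H \<Longrightarrow> x > 0 \<Longrightarrow> H x > 0"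
  by (simp add: regularly_varying_at_0_def)

lemma rv_antimono: "regularly_varying_at_0 \<rho> H \<Longrightarrow> 0 < x \<Longrightarrow> x \<le> y \<Longrightarrow> H y \<le> H x"
  by (auto simp: regularly_varying_at_0_def monotone_on_def)

lemma rv_ratio_less:
  assumes "regularly_varying_at_0 \<rho> H" and "t > 0" and "u < t powr (-\<rho>)"
  shows "eventually (\<lambda>x. u * H x < H (t * x)) (at_right 0)"
proof -
  have "((\<lambda>x. H (t * x) / H x) \<longlongrightarrow> t powr (- \<rho>)) (at_right 0)"
    using assms by (simp add: regularly_varying_at_0_def)
  then have "eventually (\<lambda>x. u < H (t * x) / H x) (at_right 0)"
    using assms(3) by (rule order_tendstoD)
  moreover have "eventually (\<lambda>x::real. x > 0) (at_right 0)"
    by (rule eventually_at_right_less)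
  ultimately show ?thesis
    by eventually_elim (use rv_pos[OF assms(1)] in \<open>simp add: pos_less_divide_eq\<close>)
qed

lemma rv_ratio_greater:
  assumes "regularly_varying_at_0 \<rho> H" and "t > 0" and "t powr (-\<rho>) < u"
  shows "eventually (\<lambda>x. H (t * x) < u * H x) (at_right 0)"
proof -
  have "((\<lambda>x. H (t * x) / H x) \<longlongrightarrow> t powr (- \<rho>)) (at_right 0)"
    using assms by (simp add: regularly_varying_at_0_def)
  then have "eventually (\<lambda>x. H (t * x) / H x < u) (at_right 0)"
    using assms(3) by (rule order_tendstoD)
  moreover have "eventually (\<lambda>x::real. x > 0) (at_right 0)"
    by (rule eventually_at_right_less)
  ultimately show ?thesis
    by eventually_elim (use rv_pos[OF assms(1)] in \<open>simp add: pos_divide_less_eq\<close>)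
qed

lemma eventually_at_right_0_scale:
  fixes t :: real
  assumes "t > 0" and "eventually P (at_right 0)"
  shows "eventually (\<lambda>x. P (t * x)) (at_right 0)"
proof -
  obtain d where d: "d > 0" "\<And>x. 0 < x \<Longrightarrow> x < d \<Longrightarrow> P x"
    using assms(2) by (auto simp: eventually_at_right_field)
  show ?thesis
    unfolding eventually_at_right_field
    by (rule exI[of _ "d / t"]) (use assms(1) d in \<open>auto simp: field_simps\<close>)
qed

text \<open>
  Halving the argument multiplies \<open>H\<close> by nearly \<open>2 powr \<rho> > 1\<close>, so \<open>H\<close> grows geometrically along
  \<open>x0 / 2 ^ k\<close>; monotonicity fills the gaps.
\<close>

lemma rv_at_top:
  assumes rv: "regularly_varying_at_0 \<rho> H" and "\<rho> > 0"
  shows "filterlim H at_top (at_right 0)"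
  unfolding filterlim_at_top
proof
  fix C :: real
  define q where "q = (1 + 2 powr \<rho>) / 2"
  have "(2::real) powr \<rho> > 1" using \<open>\<rho> > 0\<close> by (simp add: gr_one_powr)
  then have q: "q > 1" "q < 2 powr \<rho>" by (auto simp: q_def)
  have "((1/2)::real) powr (-\<rho>) = 2 powr \<rho>" by (simp add: powr_divide powr_minus field_simps)
  then have "eventually (\<lambda>x. q * H x < H (1/2 * x)) (at_right 0)"
    using q by (intro rv_ratio_less[OF rv]) auto
  then obtain d where d: "d > 0" "\<And>x. 0 < x \<Longrightarrow> x < d \<Longrightarrow> q * H x < H (1/2 * x)"
    by (auto simp: eventually_at_right_field)
  define x0 where "x0 = d / 2"
  have x0: "0 < x0" "x0 < d" using d by (auto simp: x0_def)
  have growth: "q ^ k * H x0 \<le> H ((1/2)^k * x0)" for k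
  proof (induction k)
    case (Suc k)
    have "(1/2)^k * x0 \<le> 1 * x0" using x0 by (intro mult_right_mono) (auto simp: power_le_one)
    then have "(1/2)^k * x0 < d" using x0 by linarith
    then have "q * H ((1/2)^k * x0) < H (1/2 * ((1/2)^k * x0))"
      using x0 by (intro d(2)) simp_all
    moreover have "q * (q ^ k * H x0) \<le> q * H ((1/2)^k * x0)"
      using Suc q by (intro mult_left_mono) auto
    ultimately show ?case by (simp add: mult_ac)
  qed simp
  obtain k where "C / H x0 < q ^ k" using real_arch_pow[OF q(1)] by blast
  then have "C < q ^ k * H x0" using rv_pos[OF rv x0(1)] by (simp add: field_simps)
  then have C: "C \<le> H ((1/2)^k * x0)" using growth[of k] by simp
  show "eventually (\<lambda>x. C \<le> H x) (at_right 0)"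
    unfolding eventually_at_right_field
    by (rule exI[of _ "(1/2)^k * x0"])
       (use x0 C in \<open>auto intro: order_trans[OF _ rv_antimono[OF rv]]\<close>)
qed

text \<open>
  The sublevel set in the definition of the inverse is closed and bounded away from 0, so its infimum
  belongs to it, and the intermediate value theorem rules out a strict inequality there.
\<close>

lemma gen_inverse_rv:
  assumes rv: "regularly_varying_at_0 \<rho> H" and "\<rho> > 0" and u: "u \<ge> H 1"
  shows "gen_inverse H u > 0" and "H (gen_inverse H u) = u"
proof -
  define S where "S = {x. 0 < x \<and> H x \<le> u}"
  have "eventually (\<lambda>x. u < H x) (at_right 0)"
    using rv_at_top[OF rv \<open>\<rho> > 0\<close>] by (simp add: filterlim_at_top_dense)
  then obtain d where d: "d > 0" "\<And>x. 0 < x \<Longrightarrow> x < d \<Longrightarrow> u < H x"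
    by (auto simp: eventually_at_right_field)
  have cont: "continuous_on {d/2..} H"
    by (rule continuous_on_subset[of "{0<..}"]) (use rv d in \<open>auto simp: regularly_varying_at_0_def\<close>)
  have S_eq: "S = {x \<in> {d/2..}. H x \<le> u}"
  proof -
    have "d / 2 \<le> x" if "0 < x" "H x \<le> u" for x
      using d(2)[of x] d(1) that by linarith
    then show ?thesis using d(1) by (auto simp: S_def)
  qed
  have S1: "1 \<in> S" using u by (simp add: S_def)
  have bdd: "bdd_below S" unfolding S_eq by (rule bdd_belowI[of _ "d/2"]) auto
  have "closed S" unfolding S_eq
    by (rule continuous_on_closed_Collect_le[OF cont continuous_on_const]) simp
  then have s: "Inf S \<in> S" using closed_contains_Inf[OF _ bdd] S1 by blast
  then show "gen_inverse H u > 0" by (simp add: gen_inverse_def S_def)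
  have "\<exists>x\<ge>d/2. x \<le> Inf S \<and> H x = u"
  proof (rule IVT2')
    show "H (Inf S) \<le> u" "u \<le> H (d/2)" "d / 2 \<le> Inf S"
      using s d(2)[of "d/2"] d(1) by (auto simp: S_eq)
    show "continuous_on {d/2..Inf S} H" by (rule continuous_on_subset[OF cont]) auto
  qed
  then obtain x where x: "x \<ge> d/2" "x \<le> Inf S" "H x = u" by auto
  then have "x \<in> S" using d by (auto simp: S_def)
  then have "Inf S \<le> x" using bdd by (rule cInf_lower)
  with x show "H (gen_inverse H u) = u" by (simp add: gen_inverse_def S_def)
qed

lemma gen_inverse_antimono:
  assumes "H 1 \<le> u" and "u \<le> v"
  shows "gen_inverse H v \<le> gen_inverse H u"
  unfolding gen_inverse_def
proof (rule cInf_superset_mono)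
  show "{x. 0 < x \<and> H x \<le> u} \<noteq> {}" using assms by (auto intro!: exI[of _ 1])
  show "bdd_below {x. 0 < x \<and> H x \<le> v}" by (rule bdd_belowI[of _ 0]) auto
qed (use assms in auto)

lemma gen_inverse_tendsto_0:
  assumes rv: "regularly_varying_at_0 \<rho> H" and "\<rho> > 0"
  shows "filterlim (gen_inverse H) (at_right 0) at_top"
proof (rule tendsto_imp_filterlim_at_right)
  have ge1: "eventually (\<lambda>u. u \<ge> H 1) at_top" by (rule eventually_ge_at_top)
  then show "eventually (\<lambda>u. 0 < gen_inverse H u) at_top"
    by eventually_elim (rule gen_inverse_rv[OF assms])
  show "(gen_inverse H \<longlongrightarrow> 0) at_top"
  proof (rule order_tendstoI)
    fix e :: real assume "e < 0"
    then show "eventually (\<lambda>u. e < gen_inverse H u) at_top"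
      using eventually_mono[OF ge1, of "\<lambda>u. e < gen_inverse H u"] gen_inverse_rv(1)[OF assms]
      by (meson order.strict_trans)
  next
    fix e :: real assume "0 < e"
    have "eventually (\<lambda>u. u \<ge> H (e/2)) at_top" by (rule eventually_ge_at_top)
    then show "eventually (\<lambda>u. gen_inverse H u < e) at_top"
    proof eventually_elim
      case (elim u)
      have "gen_inverse H u \<le> e / 2"
        unfolding gen_inverse_def using elim \<open>e > 0\<close>
        by (intro cInf_lower bdd_belowI[of _ 0]) auto
      then show ?case using \<open>e > 0\<close> by linarith
    qed
  qed
qed

text \<open>
  The cost of a descent in ratio \<open>y\<close>. Below a suitable level each step down multiplies \<open>H\<close> by at
  least \<open>1 / q\<close>. Hence the values of \<open>H\<close> along the levels are dominated by a geometric series whose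
  largest term is \<open>H e\<close>, and the number \<open>K\<close> of levels is even logarithmic in \<open>H e\<close>; Bernoulli's
  inequality yields the linear bound, which is enough to fit many descents into one time window.
\<close>

lemma rv_geometric_descent:
  assumes rv: "regularly_varying_at_0 \<rho> H" and "\<rho> > 0" and "y > 1"
    and q: "y powr (-\<rho>) < q" "q < 1"
  shows "\<exists>d0>0. \<forall>d. 0 < d \<and> d \<le> d0 \<longrightarrow> (\<exists>C>0. \<forall>e. 0 < e \<and> e \<le> d \<longrightarrow>
           (\<exists>K>0. d < e * y ^ K \<and> (\<forall>k<K. e * y ^ k \<le> d) \<and>
              (\<Sum>k<K. H (e * y ^ k)) \<le> H e / (1 - q) \<and> real K \<le> 1 + C * H e))"
proof -
  have q0: "q > 0" using q \<open>y > 1\<close> by (smt (verit) powr_gt_zero)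
  have "eventually (\<lambda>x. H (y * x) < q * H x) (at_right 0)"
    using \<open>y > 1\<close> q by (intro rv_ratio_greater[OF rv]) auto
  then obtain d1 where d1: "d1 > 0" "\<And>x. 0 < x \<Longrightarrow> x < d1 \<Longrightarrow> H (y * x) < q * H x"
    by (auto simp: eventually_at_right_field)
  show ?thesis
  proof (rule exI[of _ "d1/2"], intro conjI allI impI)
    show "0 < d1 / 2" using d1 by simp
    fix d assume d: "0 < d \<and> d \<le> d1 / 2"
    define C where "C = 1 / (H d * (1 / q - 1))"
    have Hd: "H d > 0" using rv_pos[OF rv] d by simp
    have qi: "1 / q - 1 > 0" using q q0 by simp
    show "\<exists>C>0. \<forall>e. 0 < e \<and> e \<le> d \<longrightarrow> (\<exists>K>0. d < e * y ^ K \<and> (\<forall>k<K. e * y ^ k \<le> d) \<and>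
              (\<Sum>k<K. H (e * y ^ k)) \<le> H e / (1 - q) \<and> real K \<le> 1 + C * H e)"
    proof (rule exI[of _ C], intro conjI allI impI)
      show "C > 0" unfolding C_def using Hd qi by simp
      fix e assume e: "0 < e \<and> e \<le> d"
      obtain n where "d / e < y ^ n" using real_arch_pow[OF \<open>y > 1\<close>] by blast
      then have ex: "d < e * y ^ n" using e by (simp add: field_simps)
      define K where "K = (LEAST n. d < e * y ^ n)"
      have K: "d < e * y ^ K" unfolding K_def using ex by (rule LeastI)
      have below: "e * y ^ k \<le> d" if "k < K" for k
        using not_less_Least[of k "\<lambda>n. d < e * y ^ n"] that by (simp add: K_def)
      have "K \<noteq> 0" using K e by (cases K) auto
      have pos: "e * y ^ k > 0" for k using e \<open>y > 1\<close> by simp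
      have step: "H (e * y ^ k) \<le> q ^ k * H e" if "k \<le> K - 1" for k
        using that
      proof (induction k)
        case (Suc k)
        then have "e * y ^ k \<le> d" by (intro below) auto
        then have "H (y * (e * y ^ k)) < q * H (e * y ^ k)"
          using d d1(1) pos by (intro d1(2)) auto
        also have "\<dots> \<le> q * (q ^ k * H e)" using Suc q0 by (intro mult_left_mono) auto
        finally show ?case by (simp add: mult_ac)
      qed simp
      have "(\<Sum>k<K. H (e * y ^ k)) \<le> (\<Sum>k<K. q ^ k * H e)"
        by (intro sum_mono step) auto
      also have "\<dots> = H e * (\<Sum>k<K. q ^ k)" by (simp add: sum_distrib_left mult.commute)
      also have "\<dots> \<le> H e * (1 / (1 - q))"
      proof (rule mult_left_mono)
        have "(\<Sum>k<K. q ^ k) \<le> (\<Sum>k. q ^ k)"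
          using q q0 by (intro sum_le_suminf) auto
        then show "(\<Sum>k<K. q ^ k) \<le> 1 / (1 - q)" using q q0 by (simp add: suminf_geometric)
        show "0 \<le> H e" using rv_pos[OF rv] e by (simp add: less_imp_le)
      qed
      finally have sum: "(\<Sum>k<K. H (e * y ^ k)) \<le> H e / (1 - q)" by simp
      have "H d \<le> H (e * y ^ (K - 1))"
        using \<open>K \<noteq> 0\<close> pos below by (intro rv_antimono[OF rv]) auto
      also have "\<dots> \<le> q ^ (K - 1) * H e" by (intro step) auto
      finally have grow: "H d * (1/q) ^ (K - 1) \<le> H e"
        using q0 by (simp add: power_divide field_simps)
      have "1 + real (K - 1) * (1/q - 1) \<le> (1 + (1/q - 1)) ^ (K - 1)"
        using qi by (intro Bernoulli_inequality) linarith
      then have "1 + real (K - 1) * (1/q - 1) \<le> (1/q) ^ (K - 1)" by simp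
      from mult_left_mono[OF this, of "H d"] Hd grow
      have "H d * (1 + real (K - 1) * (1/q - 1)) \<le> H e" by linarith
      then have "real (K - 1) * (H d * (1/q - 1)) \<le> H e" using Hd by (simp add: algebra_simps)
      then have "real (K - 1) \<le> C * H e"
        using Hd qi unfolding C_def by (simp add: pos_le_divide_eq)
      then have "real K \<le> 1 + C * H e" by simp
      with K below sum \<open>K \<noteq> 0\<close> show "\<exists>K>0. d < e * y ^ K \<and> (\<forall>k<K. e * y ^ k \<le> d) \<and>
              (\<Sum>k<K. H (e * y ^ k)) \<le> H e / (1 - q) \<and> real K \<le> 1 + C * H e"
        by (intro exI[of _ K]) auto
    qed
  qed
qed

lemma rv_gen_inverse_ln_tendsto:
  assumes "regularly_varying_at_0 \<rho> H" and "\<rho> > 0" and "c > 0"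
  shows "filterlim (\<lambda>n. c * gen_inverse H (ln (real n))) (at_right 0) sequentially"
proof -
  have "filterlim (\<lambda>n. ln (real n)) at_top sequentially" by real_asymp
  then have 1: "filterlim (\<lambda>n. gen_inverse H (ln (real n))) (at_right 0) sequentially"
    by (rule filterlim_compose[OF gen_inverse_tendsto_0[OF assms(1,2)]])
  have "filterlim (\<lambda>x. c * x) (at_right 0) (at_right (0::real))"
    using \<open>c > 0\<close> by real_asymp
  then show ?thesis by (rule filterlim_compose[OF _ 1])
qed

lemma rv_gen_inverse_ln_less:
  assumes rv: "regularly_varying_at_0 \<rho> H" and "\<rho> > 0" and "c > 0" and u: "c powr (-\<rho>) < u"
  shows "eventually (\<lambda>n. H (c * gen_inverse H (ln (real n))) < u * ln (real n)) sequentially"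
proof -
  have "filterlim (\<lambda>n. gen_inverse H (ln (real n))) (at_right 0) sequentially"
    using rv_gen_inverse_ln_tendsto[OF rv \<open>\<rho> > 0\<close>, of 1] by simp
  from eventually_compose_filterlim[OF rv_ratio_greater[OF rv \<open>c > 0\<close> u] this]
  have "eventually (\<lambda>n. H (c * gen_inverse H (ln (real n))) < u * H (gen_inverse H (ln (real n)))) sequentially" .
  moreover have "eventually (\<lambda>n. ln (real n) \<ge> H 1) sequentially" by real_asymp
  ultimately show ?thesis by eventually_elim (simp add: gen_inverse_rv(2)[OF rv \<open>\<rho> > 0\<close>])
qed

lemma rv_gen_inverse_ln_greater:
  assumes rv: "regularly_varying_at_0 \<rho> H" and "\<rho> > 0" and "c > 0" and u: "u < c powr (-\<rho>)"
  shows "eventually (\<lambda>n. u * ln (real n) < H (c * gen_inverse H (ln (real n)))) sequentially"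
proof -
  have "filterlim (\<lambda>n. gen_inverse H (ln (real n))) (at_right 0) sequentially"
    using rv_gen_inverse_ln_tendsto[OF rv \<open>\<rho> > 0\<close>, of 1] by simp
  from eventually_compose_filterlim[OF rv_ratio_less[OF rv \<open>c > 0\<close> u] this]
  have "eventually (\<lambda>n. u * H (gen_inverse H (ln (real n))) < H (c * gen_inverse H (ln (real n)))) sequentially" .
  moreover have "eventually (\<lambda>n. ln (real n) \<ge> H 1) sequentially" by real_asymp
  ultimately show ?thesis by eventually_elim (simp add: gen_inverse_rv(2)[OF rv \<open>\<rho> > 0\<close>])
qed

section \<open>Affine recursions driven by independent pairs\<close>

text \<open>
  Nonnegativity is required everywhere and not only almost surely, so that monotonicity arguments
  can be made pointwise; in the application both sequences are replaced by their positive parts.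
\<close>

locale random_affine_recursion = prob_space +
  fixes a b :: "nat \<Rightarrow> 'a \<Rightarrow> real"
  assumes indep: "indep_vars (\<lambda>_. borel) (\<lambda>n \<omega>. (a n \<omega>, b n \<omega>)) UNIV"
    and ident: "distr M borel (\<lambda>\<omega>. (a n \<omega>, b n \<omega>)) = distr M borel (\<lambda>\<omega>. (a 0 \<omega>, b 0 \<omega>))"
    and a_nonneg: "a n \<omega> \<ge> 0" and b_nonneg: "b n \<omega> \<ge> 0"
begin

primrec x :: "nat \<Rightarrow> 'a \<Rightarrow> real" where
  "x 0 \<omega> = 0"
| "x (Suc n) \<omega> = a n \<omega> * x n \<omega> + b n \<omega>"

lemma x_nonneg: "x n \<omega> \<ge> 0"
  by (induction n) (auto simp: a_nonneg b_nonneg)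

lemma pair_measurable [measurable]: "(\<lambda>\<omega>. (a n \<omega>, b n \<omega>)) \<in> borel_measurable M"
  using indep by (auto simp: indep_vars_def)

lemma a_measurable [measurable]: "a n \<in> borel_measurable M"
  using measurable_compose[OF pair_measurable[of n, folded borel_prod] measurable_fst] by simp

lemma b_measurable [measurable]: "b n \<in> borel_measurable M"
  using measurable_compose[OF pair_measurable[of n, folded borel_prod] measurable_snd] by simp

lemma x_measurable [measurable]: "x n \<in> borel_measurable M"
  by (induction n) simp_all

text \<open>
  The sigma-algebra generated by the pairs with index in \<open>I\<close>. A measure object (rather than a set of
  events) makes it possible to speak of measurability with respect to it.
\<close>

definition \<F> :: "nat set \<Rightarrow> 'a measure" where
  "\<F> I = vimage_algebra (space M) (\<lambda>\<omega>. \<lambda>i\<in>I. (a i \<omega>, b i \<omega>)) (PiM I (\<lambda>_. borel))"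

lemma space_\<F> [simp]: "space (\<F> I) = space M"
  by (simp add: \<F>_def)

lemma pair_measurable_\<F>: "i \<in> I \<Longrightarrow> (\<lambda>\<omega>. (a i \<omega>, b i \<omega>)) \<in> borel_measurable (\<F> I)"
proof -
  assume i: "i \<in> I"
  have "(\<lambda>\<omega>. \<lambda>i\<in>I. (a i \<omega>, b i \<omega>)) \<in> measurable (\<F> I) (PiM I (\<lambda>_. borel))"
    unfolding \<F>_def by (rule measurable_vimage_algebra1) (auto simp: space_PiM)
  from measurable_compose[OF this measurable_component_singleton[OF i]] i
  show ?thesis by simp
qed

lemma a_measurable_\<F>: "i \<in> I \<Longrightarrow> a i \<in> borel_measurable (\<F> I)"
  using measurable_compose[OF pair_measurable_\<F>[of i I, folded borel_prod] measurable_fst] by simp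

lemma b_measurable_\<F>: "i \<in> I \<Longrightarrow> b i \<in> borel_measurable (\<F> I)"
  using measurable_compose[OF pair_measurable_\<F>[of i I, folded borel_prod] measurable_snd] by simp

lemma sets_\<F>_mono: "I \<subseteq> J \<Longrightarrow> sets (\<F> I) \<subseteq> sets (\<F> J)"
  unfolding \<F>_def[of I]
  by (rule sets_image_in_sets)
     (auto intro!: measurable_restrict pair_measurable_\<F>)

lemma sets_\<F>_events: "E \<in> sets (\<F> I) \<Longrightarrow> E \<in> events"
proof -
  have "sets (\<F> I) \<subseteq> events"
    unfolding \<F>_def by (rule sets_image_in_sets) (auto intro!: measurable_restrict)
  then show "E \<in> sets (\<F> I) \<Longrightarrow> E \<in> events" by blast
qed

lemma indep_\<F>:
  assumes "E \<in> sets (\<F> I)" and "F \<in> sets (\<F> J)" and "I \<inter> J = {}"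
  shows "prob (E \<inter> F) = prob E * prob F"
proof -
  let ?f = "\<lambda>I \<omega>. \<lambda>i\<in>I. (a i \<omega>, b i \<omega>)"
  have "?f I \<in> space M \<rightarrow> space (PiM I (\<lambda>_. borel))" for I by (auto simp: space_PiM)
  then have eq: "sets (\<F> I) = {?f I -` A \<inter> space M | A. A \<in> sets (PiM I (\<lambda>_. borel))}" for I
    unfolding \<F>_def by (rule sets_vimage_algebra2)
  obtain A B where AB: "A \<in> sets (PiM I (\<lambda>_. borel))" "E = ?f I -` A \<inter> space M"
      "B \<in> sets (PiM J (\<lambda>_. borel))" "F = ?f J -` B \<inter> space M"
    using assms unfolding eq by blast
  have "indep_var (PiM I (\<lambda>_. borel)) (?f I) (PiM J (\<lambda>_. borel)) (?f J)"
    using assms(3) by (intro indep_var_restrict[OF indep]) auto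
  from indep_varD[OF this AB(1,3)] show ?thesis
    by (simp add: AB(2,4) Int_def vimage_def mem_Times_iff conj_ac)
qed

lemma indep_var_\<F>:
  fixes U V :: "'a \<Rightarrow> real"
  assumes "U \<in> borel_measurable (\<F> I)" and "V \<in> borel_measurable (\<F> J)" and "I \<inter> J = {}"
  shows "indep_var borel U borel V"
proof -
  have rv: "U \<in> borel_measurable M" "V \<in> borel_measurable M"
    using measurable_sets[OF assms(1)] measurable_sets[OF assms(2)]
    by (auto intro!: measurableI sets_\<F>_events)
  have sig: "sigma_sets (space M) {U -` A \<inter> space M |A. A \<in> sets borel} \<subseteq> sets (\<F> I)"
    if "U \<in> borel_measurable (\<F> I)" for U :: "'a \<Rightarrow> real" and I
    using sets.sigma_sets_subset[of "{U -` A \<inter> space M |A. A \<in> sets borel}" "\<F> I"]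
      measurable_sets[OF that] by auto
  show ?thesis
    unfolding indep_var_eq using rv
    by (auto intro!: indep_setI sets_\<F>_events
          dest: sig[OF assms(1), THEN subsetD] sig[OF assms(2), THEN subsetD]
          intro: indep_\<F>[OF _ _ assms(3)])
qed

lemma x_measurable_\<F>: "n \<le> m \<Longrightarrow> x n \<in> borel_measurable (\<F> {..<m})"
proof (induction n)
  case (Suc n)
  then show ?case
    by (simp add: x.simps(2)[abs_def] borel_measurable_add borel_measurable_times a_measurable_\<F> b_measurable_\<F>)
qed (simp add: x.simps(1)[abs_def])

lemma distr_step:
  fixes f :: "real \<times> real \<Rightarrow> 'c::topological_space"
  assumes [measurable]: "f \<in> borel_measurable borel"
  shows "distr M borel (\<lambda>\<omega>. f (a n \<omega>, b n \<omega>)) = distr M borel (\<lambda>\<omega>. f (a 0 \<omega>, b 0 \<omega>))"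
proof -
  have "distr M borel (\<lambda>\<omega>. f (a n \<omega>, b n \<omega>)) = distr (distr M borel (\<lambda>\<omega>. (a n \<omega>, b n \<omega>))) borel f" for n
    by (subst distr_distr) (auto simp: comp_def)
  from this[of n] this[of 0] show ?thesis by (simp only: ident[of n])
qed

lemma prob_step:
  assumes P: "Measurable.pred borel P"
  shows "prob {\<omega> \<in> space M. P (a n \<omega>, b n \<omega>)} = prob {\<omega> \<in> space M. P (a 0 \<omega>, b 0 \<omega>)}"
proof -
  have "prob {\<omega> \<in> space M. P (a n \<omega>, b n \<omega>)} = measure (distr M borel (\<lambda>\<omega>. (a n \<omega>, b n \<omega>))) {z. P z}" for n
  proof -
    have "{z. P z} \<in> sets borel" using P by (simp add: pred_def)
    from measure_distr[OF pair_measurable this, of n] show ?thesis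
      by (simp add: vimage_def Int_def conj_commute)
  qed
  from this[of n] this[of 0] show ?thesis by (simp only: ident[of n])
qed

text \<open>
  Fubini's theorem for a pair of independent variables, in the form of a one-step transition kernel.
\<close>

lemma nn_integral_prod_indep:
  fixes U V :: "'a \<Rightarrow> real"
  assumes "indep_var borel U borel V"
    and [measurable]: "\<phi> \<in> borel_measurable (borel \<Otimes>\<^sub>M borel)"
  shows "(\<integral>\<^sup>+\<omega>. \<phi> (U \<omega>, V \<omega>) \<partial>M) = (\<integral>\<^sup>+\<omega>. \<integral>\<^sup>+z. \<phi> (U \<omega>, z) \<partial>distr M borel V \<partial>M)"
proof -
  have [measurable]: "U \<in> borel_measurable M" "V \<in> borel_measurable M"
    using assms(1) by (auto dest: indep_var_rv1 indep_var_rv2)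
  interpret V: prob_space "distr M borel V" by (rule prob_space_distr) simp
  have *: "distr M (borel \<Otimes>\<^sub>M borel) (\<lambda>\<omega>. (U \<omega>, V \<omega>)) = distr M borel U \<Otimes>\<^sub>M distr M borel V"
    using assms(1) by (simp add: indep_var_distribution_eq)
  have "(\<integral>\<^sup>+\<omega>. \<phi> (U \<omega>, V \<omega>) \<partial>M) = (\<integral>\<^sup>+p. \<phi> p \<partial>distr M (borel \<Otimes>\<^sub>M borel) (\<lambda>\<omega>. (U \<omega>, V \<omega>)))"
    by (rule nn_integral_distr[symmetric]) measurable
  also have "\<dots> = (\<integral>\<^sup>+u. \<integral>\<^sup>+z. \<phi> (u, z) \<partial>distr M borel V \<partial>distr M borel U)"
    unfolding * by (subst V.nn_integral_fst[symmetric]) (auto cong: measurable_cong_sets)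
  also have "\<dots> = (\<integral>\<^sup>+\<omega>. \<integral>\<^sup>+z. \<phi> (U \<omega>, z) \<partial>distr M borel V \<partial>M)"
    by (rule nn_integral_distr) measurable
  finally show ?thesis .
qed

text \<open>
  A random walk with negative drift that is reflected at 0 sits at 0 with probability bounded below.
  Pointwise, \<open>W (k + 1) - W k\<close> is at most the increment, plus \<open>T\<close> if \<open>W (k + 1) = 0\<close>. The
  expectation of \<open>W\<close> does not decrease, so the drift has to be compensated by \<open>T\<close> times the
  probability of being at 0. This replaces the strong law of large numbers: the event \<open>W k = 0\<close> says
  that all sums of increments that end at the present time are nonpositive.
\<close>

lemma lindley_recurrence:
  fixes z :: "real \<times> real \<Rightarrow> real" and W :: "nat \<Rightarrow> 'a \<Rightarrow> real"
  assumes z[measurable]: "z \<in> borel_measurable borel"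
    and int: "integrable M (\<lambda>\<omega>. z (a 0 \<omega>, b 0 \<omega>))"
    and bdd: "\<And>p. z p \<ge> - T" and "T > 0"
    and W0: "\<And>\<omega>. W 0 \<omega> = 0"
    and W_Suc: "\<And>k \<omega>. W (Suc k) \<omega> = max 0 (W k \<omega> + z (a (m + k) \<omega>, b (m + k) \<omega>))"
  shows "prob {\<omega> \<in> space M. W (Suc k) \<omega> = 0} \<ge> - (\<integral>\<omega>. z (a 0 \<omega>, b 0 \<omega>) \<partial>M) / T"
proof -
  define Z where "Z n \<omega> = z (a n \<omega>, b n \<omega>)" for n \<omega>
  have W_Suc': "W (Suc k) = (\<lambda>\<omega>. max 0 (W k \<omega> + Z (m + k) \<omega>))" for k
    by (auto simp: W_Suc Z_def)
  have W_0': "W 0 = (\<lambda>\<omega>. 0)" by (auto simp: W0)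
  have Z_\<F>: "i \<in> I \<Longrightarrow> Z i \<in> borel_measurable (\<F> I)" for i I
    unfolding Z_def by (rule measurable_compose[OF pair_measurable_\<F> z])
  have [measurable]: "Z n \<in> borel_measurable M" for n
    unfolding Z_def by measurable
  have distr_Z: "distr M borel (Z n) = distr M borel (Z 0)" for n
    unfolding Z_def by (rule distr_step) simp
  have int_Z: "integrable M (Z n)" "(\<integral>\<omega>. Z n \<omega> \<partial>M) = (\<integral>\<omega>. Z 0 \<omega> \<partial>M)" for n
  proof -
    have "integrable (distr M borel (Z 0)) (\<lambda>x. x)"
      using int by (subst integrable_distr_eq) (auto simp: Z_def[abs_def])
    then have "integrable (distr M borel (Z n)) (\<lambda>x. x)" by (simp only: distr_Z[of n])
    then show "integrable M (Z n)" by (subst (asm) integrable_distr_eq) auto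
    have "(\<integral>\<omega>. Z n \<omega> \<partial>M) = (\<integral>x. x \<partial>distr M borel (Z n))" for n
      by (subst integral_distr) auto
    from this[of n] this[of 0] show "(\<integral>\<omega>. Z n \<omega> \<partial>M) = (\<integral>\<omega>. Z 0 \<omega> \<partial>M)"
      by (simp only: distr_Z[of n])
  qed
  have W_\<F>: "W k \<in> borel_measurable (\<F> {m..<m + k})" for k
  proof (induction k)
    case (Suc k)
    have "sets (\<F> {m..<m + k}) \<subseteq> sets (\<F> {m..<m + Suc k})" by (rule sets_\<F>_mono) auto
    then have "W k \<in> borel_measurable (\<F> {m..<m + Suc k})"
      using Suc by (auto simp: measurable_def)
    then show ?case unfolding W_Suc'
      by (intro borel_measurable_max borel_measurable_add borel_measurable_const Z_\<F>) auto
  qed (simp add: W_0')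
  have [measurable]: "W k \<in> borel_measurable M" for k
    by (induction k) (simp_all add: W_0' W_Suc')
  have W_nonneg: "W k \<omega> \<ge> 0" for k \<omega>
    by (cases k) (auto simp: W_0' W_Suc')
  have int_W: "integrable M (W k)" for k
    by (induction k) (auto simp: W_0' W_Suc' int_Z(1))
  \<comment> \<open>The chain is stochastically increasing, because it starts in the least state and its
      transition kernel preserves monotone functions.\<close>
  have mono: "(\<integral>\<^sup>+\<omega>. \<phi> (W k \<omega>) \<partial>M) \<le> (\<integral>\<^sup>+\<omega>. \<phi> (W (Suc k) \<omega>) \<partial>M)"
    if "mono \<phi>" and [measurable]: "\<phi> \<in> borel_measurable borel" for \<phi> :: "real \<Rightarrow> ennreal" and k
    using that
  proof (induction k arbitrary: \<phi>)
    case 0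
    then have "\<phi> (W 0 \<omega>) \<le> \<phi> (W (Suc 0) \<omega>)" for \<omega>
      by (intro monoD[OF 0(1)]) (simp add: W_0' W_nonneg)
    then show ?case by (intro nn_integral_mono)
  next
    case (Suc k)
    note [measurable] = Suc.prems(2)
    define \<psi> where "\<psi> w = (\<integral>\<^sup>+z. \<phi> (max 0 (w + z)) \<partial>distr M borel (Z 0))" for w
    interpret Z0: prob_space "distr M borel (Z 0)" by (rule prob_space_distr) simp
    have step: "(\<integral>\<^sup>+\<omega>. \<phi> (W (Suc j) \<omega>) \<partial>M) = (\<integral>\<^sup>+\<omega>. \<psi> (W j \<omega>) \<partial>M)" for j
    proof -
      have "indep_var borel (W j) borel (Z (m + j))"
        by (rule indep_var_\<F>[OF W_\<F>[of j] Z_\<F>[of _ "{m + j}"]]) auto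
      from nn_integral_prod_indep[OF this, of "\<lambda>(w, z). \<phi> (max 0 (w + z))"]
      show ?thesis by (simp add: W_Suc' \<psi>_def distr_Z[of "m + j"])
    qed
    have "mono \<psi>"
      unfolding \<psi>_def by (intro monoI nn_integral_mono monoD[OF Suc.prems(1)]) auto
    moreover have "\<psi> \<in> borel_measurable borel"
      unfolding \<psi>_def by measurable
    ultimately show ?case unfolding step by (rule Suc.IH)
  qed
  have EW: "(\<integral>\<omega>. W k \<omega> \<partial>M) \<le> (\<integral>\<omega>. W (Suc k) \<omega> \<partial>M)"
  proof -
    have "(\<integral>\<^sup>+\<omega>. ennreal (W k \<omega>) \<partial>M) \<le> (\<integral>\<^sup>+\<omega>. ennreal (W (Suc k) \<omega>) \<partial>M)"
      by (rule mono) (auto intro!: monoI ennreal_leI)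
    then show ?thesis
      by (simp add: nn_integral_eq_integral int_W W_nonneg ennreal_le_iff integral_nonneg)
  qed
  define S where "S = {\<omega> \<in> space M. W (Suc k) \<omega> = 0}"
  have [measurable]: "S \<in> events" unfolding S_def by measurable
  have "(\<integral>\<omega>. W (Suc k) \<omega> - W k \<omega> \<partial>M) \<le> (\<integral>\<omega>. Z (m + k) \<omega> + T * indicator S \<omega> \<partial>M)"
  proof (rule integral_mono)
    show "integrable M (\<lambda>\<omega>. W (Suc k) \<omega> - W k \<omega>)" by (intro Bochner_Integration.integrable_diff int_W)
    show "integrable M (\<lambda>\<omega>. Z (m + k) \<omega> + T * indicator S \<omega>)"
      by (intro Bochner_Integration.integrable_add int_Z(1) integrable_mult_right) (simp add: integrable_indicator_iff less_top[symmetric])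
    fix \<omega> assume "\<omega> \<in> space M"
    moreover have "Z (m + k) \<omega> \<ge> - T" using bdd by (simp add: Z_def)
    ultimately show "W (Suc k) \<omega> - W k \<omega> \<le> Z (m + k) \<omega> + T * indicator S \<omega>"
      using W_nonneg[of k \<omega>] by (auto simp: W_Suc' S_def indicator_def max_def)
  qed
  also have "\<dots> = (\<integral>\<omega>. Z 0 \<omega> \<partial>M) + T * prob S"
    by (subst Bochner_Integration.integral_add) (auto simp: int_Z(1) int_Z(2)[of "m + k"] integrable_indicator_iff less_top[symmetric])
  finally have "0 \<le> (\<integral>\<omega>. Z 0 \<omega> \<partial>M) + T * prob S"
    using EW by (simp add: int_W)
  then show ?thesis using \<open>T > 0\<close> by (simp add: Z_def S_def field_simps)
qed

section \<open>Boundedness in probability\<close>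

text \<open>
  Given any event \<open>F\<close> of the past, the recursion is eventually below \<open>u\<close> with conditional probability
  at least \<open>p\<close>, at every later time. The time \<open>n0\<close> may depend on \<open>F\<close>, but \<open>p\<close> may not.
\<close>

definition hits_below :: "real \<Rightarrow> bool" where
  "hits_below u \<longleftrightarrow> (\<exists>p>0. \<forall>m. \<forall>F\<in>sets (\<F> {..<m}). \<exists>n0\<ge>m. \<forall>n\<ge>n0.
     prob {\<omega> \<in> F. x n \<omega> < u} \<ge> p * prob F)"

text \<open>
  The number of \<open>j\<close> with \<open>b 0 > s ^ j\<close> is at most \<open>1 + max 0 (ln (b 0)) / ln s\<close>. The sum of the
  probabilities is the expectation of this number.
\<close>

lemma summable_tail_powers:
  assumes int: "integrable M (\<lambda>\<omega>. max 0 (ln (b 0 \<omega>)))" and "s > 1"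
  shows "summable (\<lambda>j. prob {\<omega> \<in> space M. b 0 \<omega> > s ^ j})"
proof (rule bounded_imp_summable)
  show "0 \<le> prob {\<omega> \<in> space M. b 0 \<omega> > s ^ j}" for j by simp
  fix n
  define A where "A j = {\<omega> \<in> space M. b 0 \<omega> > s ^ j}" for j
  have [measurable]: "A j \<in> events" for j unfolding A_def by measurable
  have ls: "ln s > 0" using \<open>s > 1\<close> by simp
  have count: "(\<Sum>j\<le>n. indicator (A j) \<omega>) \<le> 1 + max 0 (ln (b 0 \<omega>)) / ln s" for \<omega>
  proof -
    define v where "v = max 0 (ln (b 0 \<omega>)) / ln s"
    have v: "v \<ge> 0" using ls by (simp add: v_def)
    have "j < nat \<lceil>v\<rceil>" if "\<omega> \<in> A j" for j
    proof -
      have "s ^ j < b 0 \<omega>" using that by (simp add: A_def)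
      moreover have "s ^ j > 0" using \<open>s > 1\<close> by simp
      ultimately have "ln (s ^ j) < ln (b 0 \<omega>)" by (subst ln_less_cancel_iff) auto
      then have "real j * ln s < ln (b 0 \<omega>)" using \<open>s > 1\<close> by (simp add: ln_realpow)
      then have "real j < v" using ls unfolding v_def by (simp add: pos_less_divide_eq max_def)
      then show ?thesis by linarith
    qed
    then have "{j \<in> {..n}. \<omega> \<in> A j} \<subseteq> {..<nat \<lceil>v\<rceil>}" by auto
    from card_mono[OF _ this] have "card {j \<in> {..n}. \<omega> \<in> A j} \<le> nat \<lceil>v\<rceil>" by simp
    moreover have "(\<Sum>j\<le>n. indicator (A j) \<omega>) = real (card {j \<in> {..n}. \<omega> \<in> A j})"
      by (simp add: indicator_def sum.If_cases Int_def)
    ultimately show ?thesis using v unfolding v_def[symmetric] by linarith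
  qed
  have "(\<Sum>j\<le>n. prob (A j)) = (\<integral>\<omega>. (\<Sum>j\<le>n. indicator (A j) \<omega>) \<partial>M)"
    by (subst Bochner_Integration.integral_sum) (auto simp: integrable_indicator_iff less_top[symmetric])
  also have "\<dots> \<le> (\<integral>\<omega>. 1 + max 0 (ln (b 0 \<omega>)) / ln s \<partial>M)"
    by (rule integral_mono)
       (auto intro!: Bochner_Integration.integrable_sum Bochner_Integration.integrable_add
          integrable_divide int count simp: integrable_indicator_iff less_top[symmetric])
  finally show "(\<Sum>j\<le>n. prob {\<omega> \<in> space M. b 0 \<omega> > s ^ j})
      \<le> (\<integral>\<omega>. 1 + max 0 (ln (b 0 \<omega>)) / ln s \<partial>M)" by (simp add: A_def)
qed

text \<open>
  Let the reflected walk \<open>W\<close> have the increments \<open>ln a + \<eta>\<close>, with \<open>ln a\<close> truncated below and \<open>\<eta>\<close>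
  so small that the drift stays negative, and let \<open>Y\<close> be the recursion with the constant factor
  \<open>exp (- \<eta>)\<close> in place of \<open>a\<close>, both started at time \<open>m\<close>. Then \<open>x\<close> is bounded by \<open>exp W\<close> times
  (the decayed initial value plus \<open>Y\<close>). The event \<open>W = 0\<close> has probability at least \<open>p0\<close>, and \<open>Y\<close>
  is large with probability at most \<open>p0 / 2\<close>, by a union bound over the times of large \<open>b\<close>. Both
  events concern times from \<open>m\<close> on only, so they are independent of the past event \<open>F\<close>.
\<close>

lemma negative_drift_hits_below:
  assumes T: "T > 0"
    and int_a: "integrable M (\<lambda>\<omega>. ln (max (a 0 \<omega>) (exp (- T))))"
    and drift: "(\<integral>\<omega>. ln (max (a 0 \<omega>) (exp (- T))) \<partial>M) < 0"
    and int_b: "integrable M (\<lambda>\<omega>. max 0 (ln (b 0 \<omega>)))"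
  shows "\<exists>R. hits_below R"
proof -
  define \<mu> where "\<mu> = - (\<integral>\<omega>. ln (max (a 0 \<omega>) (exp (- T))) \<partial>M)"
  have \<mu>: "\<mu> > 0" using drift by (simp add: \<mu>_def)
  define \<eta> where "\<eta> = \<mu> / 2"
  define z :: "real \<times> real \<Rightarrow> real" where "z = (\<lambda>p. ln (max (fst p) (exp (- T))) + \<eta>)"
  have z_meas: "z \<in> borel_measurable borel"
    unfolding z_def borel_prod[symmetric] by measurable
  have z_int: "integrable M (\<lambda>\<omega>. z (a 0 \<omega>, b 0 \<omega>))"
    unfolding z_def using int_a by simp
  have z_exp: "(\<integral>\<omega>. z (a 0 \<omega>, b 0 \<omega>) \<partial>M) = - \<eta>"
    unfolding z_def using int_a by (simp add: \<mu>_def \<eta>_def prob_space)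
  have z_ge: "z p \<ge> - T" for p
  proof -
    have "ln (exp (- T)) \<le> ln (max (fst p) (exp (- T)))"
      by (subst ln_le_cancel_iff) (auto simp: less_max_iff_disj)
    then show ?thesis using \<mu> by (simp add: z_def \<eta>_def)
  qed
  define p0 where "p0 = \<eta> / T"
  have p0: "p0 > 0" using \<mu> T by (simp add: p0_def \<eta>_def)
  define s where "s = exp (\<eta> / 2)"
  have s: "s > 1" using \<mu> by (simp add: s_def \<eta>_def)
  have exp_\<eta>: "exp (- \<eta>) = 1 / s ^ 2"
    by (simp add: s_def exp_minus field_simps flip: exp_of_nat_mult)
  define \<tau> where "\<tau> j = prob {\<omega> \<in> space M. b 0 \<omega> > s ^ j}" for j
  have \<tau>_nonneg: "\<tau> j \<ge> 0" for j by (simp add: \<tau>_def)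
  have sum_\<tau>: "summable \<tau>" unfolding \<tau>_def by (rule summable_tail_powers[OF int_b s])
  obtain j0 where j0: "\<And>k. (\<Sum>j<k. \<tau> (j + j0)) \<le> p0 / 2"
  proof -
    obtain N where N: "\<And>n. n \<ge> N \<Longrightarrow> norm (\<Sum>i. \<tau> (i + n)) < p0 / 2"
      using suminf_exist_split[OF _ sum_\<tau>, of "p0 / 2"] p0 by auto
    show ?thesis
    proof (rule that[of N])
      fix k
      have "(\<Sum>j<k. \<tau> (j + N)) \<le> (\<Sum>j. \<tau> (j + N))"
        using sum_\<tau> by (intro sum_le_suminf) (simp_all add: summable_iff_shift \<tau>_nonneg)
      also have "\<dots> \<le> p0 / 2" using N[of N] by auto
      finally show "(\<Sum>j<k. \<tau> (j + N)) \<le> p0 / 2" .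
    qed
  qed
  define C where "C = s ^ j0 / (1 - 1 / s)"
  show ?thesis
    unfolding hits_below_def
  proof (rule exI[of _ "C + 1"], rule exI[of _ "p0 / 4"], intro conjI allI ballI)
    show "0 < p0 / 4" using p0 by simp
    fix m F assume F: "F \<in> sets (\<F> {..<m})"
    define W where "W = rec_nat (\<lambda>\<omega>. 0) (\<lambda>k w \<omega>. max 0 (w \<omega> + z (a (m + k) \<omega>, b (m + k) \<omega>)))"
    define Y where "Y = rec_nat (\<lambda>\<omega>. 0) (\<lambda>k v \<omega>. exp (- \<eta>) * v \<omega> + b (m + k) \<omega>)"
    have W0: "W 0 = (\<lambda>\<omega>. 0)"
      and W_Suc: "W (Suc k) = (\<lambda>\<omega>. max 0 (W k \<omega> + z (a (m + k) \<omega>, b (m + k) \<omega>)))" for k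
      by (auto simp: W_def)
    have Y0: "Y 0 = (\<lambda>\<omega>. 0)"
      and Y_Suc: "Y (Suc k) = (\<lambda>\<omega>. exp (- \<eta>) * Y k \<omega> + b (m + k) \<omega>)" for k
      by (auto simp: Y_def)
    have W_\<F>: "W k \<in> borel_measurable (\<F> {m..})" for k
      by (induction k)
         (auto simp: W0 W_Suc intro!: borel_measurable_max borel_measurable_add
            measurable_compose[OF pair_measurable_\<F> z_meas])
    have Y_\<F>: "Y k \<in> borel_measurable (\<F> {m..})" for k
      by (induction k)
         (auto simp: Y0 Y_Suc intro!: borel_measurable_add borel_measurable_times b_measurable_\<F>)
    have [measurable]: "W k \<in> borel_measurable M" "Y k \<in> borel_measurable M" for k
      using measurable_sets[OF W_\<F>] measurable_sets[OF Y_\<F>]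
      by (auto intro!: measurableI sets_\<F>_events)
    have W_nonneg: "W k \<omega> \<ge> 0" for k \<omega> by (cases k) (auto simp: W0 W_Suc)
    \<comment> \<open>\<open>W\<close> grows by at least \<open>ln a + \<eta>\<close>, which pays for the factor \<open>a\<close>; it is nonnegative, which
        pays for the summand \<open>b\<close>.\<close>
    have path: "x (m + k) \<omega> \<le> exp (W k \<omega>) * (exp (- \<eta>) ^ k * x m \<omega> + Y k \<omega>)" for k \<omega>
    proof (induction k)
      case (Suc k)
      let ?Z = "z (a (m + k) \<omega>, b (m + k) \<omega>)"
      let ?U = "exp (- \<eta>) ^ k * x m \<omega> + Y k \<omega>"
      have Y_nonneg: "Y k \<omega> \<ge> 0" by (induction k) (auto simp: Y0 Y_Suc b_nonneg)
      have "a (m + k) \<omega> \<le> max (a (m + k) \<omega>) (exp (- T))" by simp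
      also have "\<dots> = exp (?Z - \<eta>)" by (simp add: z_def less_max_iff_disj)
      finally have "a (m + k) \<omega> * x (m + k) \<omega> \<le> exp (?Z - \<eta>) * (exp (W k \<omega>) * ?U)"
        using Suc x_nonneg by (intro mult_mono) auto
      also have "\<dots> = exp (W k \<omega> + ?Z) * (exp (- \<eta>) * ?U)"
        by (simp add: exp_add exp_diff exp_minus field_simps)
      also have "\<dots> \<le> exp (W (Suc k) \<omega>) * (exp (- \<eta>) * ?U)"
        using Y_nonneg x_nonneg by (intro mult_right_mono) (auto simp: W_Suc)
      finally have 1: "a (m + k) \<omega> * x (m + k) \<omega> \<le> exp (W (Suc k) \<omega>) * (exp (- \<eta>) * ?U)" .
      have "1 * b (m + k) \<omega> \<le> exp (W (Suc k) \<omega>) * b (m + k) \<omega>"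
        using b_nonneg W_nonneg by (intro mult_right_mono) auto
      with 1 show ?case by (simp add: Y_Suc algebra_simps)
    qed (simp add: W0 Y0)
    \<comment> \<open>As \<open>exp (- \<eta>) = 1 / s ^ 2\<close>, terms of \<open>b\<close> that grow at most like \<open>s ^ j\<close> into the past
        contribute a geometric series of ratio \<open>1 / s\<close> to \<open>Y\<close>.\<close>
    have Y_le: "Y k \<omega> \<le> D / (1 - 1 / s)"
      if "\<And>i. i < k \<Longrightarrow> b (m + i) \<omega> \<le> D * s ^ (k - Suc i)" "D \<ge> 0" for k D \<omega>
      using that
    proof (induction k arbitrary: D)
      case 0
      then show ?case using s by (simp add: Y0)
    next
      case (Suc k)
      have "b (m + i) \<omega> \<le> D * s * s ^ (k - Suc i)" if "i < k" for i
        using Suc.prems(1)[of i] that by (simp add: Suc_diff_Suc[symmetric] mult_ac)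
      then have "Y k \<omega> \<le> D * s / (1 - 1 / s)"
        using Suc.prems(2) s by (intro Suc.IH) auto
      then have "exp (- \<eta>) * Y k \<omega> \<le> exp (- \<eta>) * (D * s / (1 - 1 / s))"
        by (intro mult_left_mono) auto
      moreover have "b (m + k) \<omega> \<le> D" using Suc.prems(1)[of k] by simp
      moreover have "exp (- \<eta>) * (D * s / (1 - 1 / s)) + D = D / (1 - 1 / s)"
        unfolding exp_\<eta> using s by (simp add: field_simps power2_eq_square)
      ultimately show ?case unfolding Y_Suc by linarith
    qed
    have Y_tail: "prob {\<omega> \<in> space M. Y k \<omega> > C} \<le> p0 / 2" for k
    proof -
      define B where "B i = {\<omega> \<in> space M. b (m + i) \<omega> > s ^ ((k - Suc i) + j0)}" for i
      have [measurable]: "B i \<in> events" for i unfolding B_def by measurable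
      have "{\<omega> \<in> space M. Y k \<omega> > C} \<subseteq> (\<Union>i<k. B i)"
      proof (rule subsetI, rule ccontr)
        fix \<omega> assume \<omega>: "\<omega> \<in> {\<omega> \<in> space M. Y k \<omega> > C}" and n: "\<omega> \<notin> (\<Union>i<k. B i)"
        have "b (m + i) \<omega> \<le> s ^ j0 * s ^ (k - Suc i)" if "i < k" for i
        proof -
          have "b (m + i) \<omega> \<le> s ^ ((k - Suc i) + j0)"
            using n \<omega> that by (auto simp: B_def not_less)
          then show ?thesis by (simp only: power_add mult.commute)
        qed
        then have "Y k \<omega> \<le> s ^ j0 / (1 - 1 / s)" using s by (intro Y_le) auto
        with \<omega> show False by (simp add: C_def)
      qed
      then have "prob {\<omega> \<in> space M. Y k \<omega> > C} \<le> prob (\<Union>i<k. B i)"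
        by (intro finite_measure_mono) auto
      also have "\<dots> \<le> (\<Sum>i<k. prob (B i))"
        by (rule finite_measure_subadditive_finite) auto
      also have "\<dots> = (\<Sum>i<k. \<tau> (k - Suc i + j0))"
      proof (rule sum.cong)
        fix i
        have "Measurable.pred borel (\<lambda>p::real \<times> real. snd p > s ^ (k - Suc i + j0))"
          unfolding borel_prod[symmetric] by measurable
        from prob_step[OF this, of "m + i"]
        show "prob (B i) = \<tau> (k - Suc i + j0)" by (simp add: B_def \<tau>_def)
      qed simp
      also have "\<dots> = (\<Sum>j<k. \<tau> (j + j0))"
        by (rule sum.nat_diff_reindex)
      finally show ?thesis using j0[of k] by simp
    qed
    define E where "E k = {\<omega> \<in> space M. W k \<omega> = 0 \<and> Y k \<omega> \<le> C}" for k
    have E_\<F>: "E k \<in> sets (\<F> {m..})" for k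
    proof -
      note [measurable] = W_\<F>[of k] Y_\<F>[of k]
      have "{\<omega> \<in> space (\<F> {m..}). W k \<omega> = 0 \<and> Y k \<omega> \<le> C} \<in> sets (\<F> {m..})" by measurable
      then show ?thesis by (simp add: E_def)
    qed
    have prob_E: "prob (E (Suc k)) \<ge> p0 / 2" for k
    proof -
      have "p0 \<le> prob {\<omega> \<in> space M. W (Suc k) \<omega> = 0}"
        using lindley_recurrence[OF z_meas z_int z_ge T, of W m k]
        by (simp add: W0 W_Suc z_exp p0_def)
      also have "\<dots> \<le> prob (E (Suc k) \<union> {\<omega> \<in> space M. Y (Suc k) \<omega> > C})"
        by (intro finite_measure_mono) (auto simp: E_def)
      also have "\<dots> \<le> prob (E (Suc k)) + prob {\<omega> \<in> space M. Y (Suc k) \<omega> > C}"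
        by (rule measure_Un_le) (auto simp: E_def)
      finally show ?thesis using Y_tail[of "Suc k"] by linarith
    qed
    define FN where "FN N = F \<inter> {\<omega> \<in> space M. x m \<omega> \<le> real N}" for N
    have FN_\<F>: "FN N \<in> sets (\<F> {..<m})" for N
    proof -
      note [measurable] = x_measurable_\<F>[OF order_refl, of m]
      have "{\<omega> \<in> space (\<F> {..<m}). x m \<omega> \<le> real N} \<in> sets (\<F> {..<m})" by measurable
      then show ?thesis using F by (simp add: FN_def)
    qed
    have F_sub: "F \<subseteq> space M" using sets.sets_into_space[OF F] by simp
    have F_ev: "F \<in> events" by (rule sets_\<F>_events[OF F])
    \<comment> \<open>The value at time \<open>m\<close> is finite, so it is at most some \<open>N\<close> on half of \<open>F\<close>.\<close>
    obtain N where N: "prob (FN N) \<ge> prob F / 2"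
    proof (cases "prob F = 0")
      case True
      then show ?thesis using that[of 0] by simp
    next
      case False
      have "(\<lambda>N. prob (FN N)) \<longlonglongrightarrow> prob (\<Union>N. FN N)"
        by (rule finite_Lim_measure_incseq)
           (auto simp: FN_def incseq_def intro!: sets.Int F_ev)
      also have "(\<Union>N. FN N) = F"
        using F_sub by (auto simp: FN_def real_arch_simple)
      finally have "eventually (\<lambda>N. prob F / 2 < prob (FN N)) sequentially"
        using False measure_nonneg[of M F] by (intro order_tendstoD(1)) (auto simp: less_le)
      then show ?thesis using that by (auto simp: eventually_sequentially intro: less_imp_le)
    qed
    have "exp (- \<eta>) < 1" using \<mu> by (simp add: \<eta>_def)
    then have "(\<lambda>k. exp (- \<eta>) ^ k * real N) \<longlonglongrightarrow> 0 * real N"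
      by (intro tendsto_mult_right LIMSEQ_power_zero) auto
    then have "eventually (\<lambda>k. exp (- \<eta>) ^ k * real N < 1) sequentially"
      by (intro order_tendstoD) auto
    then obtain k0 where k0: "\<And>k. k \<ge> k0 \<Longrightarrow> exp (- \<eta>) ^ k * real N < 1"
      by (auto simp: eventually_sequentially)
    show "\<exists>n0\<ge>m. \<forall>n\<ge>n0. prob {\<omega> \<in> F. x n \<omega> < C + 1} \<ge> p0 / 4 * prob F"
    proof (intro exI[of _ "m + Suc k0"] conjI allI impI)
      fix n assume n: "m + Suc k0 \<le> n"
      define k where "k = n - m"
      have k: "n = m + k" "k \<ge> k0" "k = Suc (k - 1)" using n by (auto simp: k_def)
      have "p0 / 4 * prob F = (prob F / 2) * (p0 / 2)" by simp
      also have "\<dots> \<le> prob (FN N) * prob (E k)"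
        using N prob_E[of "k - 1"] k(3) p0 by (intro mult_mono) auto
      also have "\<dots> = prob (FN N \<inter> E k)"
        by (rule indep_\<F>[OF FN_\<F> E_\<F>, symmetric]) auto
      also have "\<dots> \<le> prob {\<omega> \<in> F. x n \<omega> < C + 1}"
      proof (rule finite_measure_mono)
        have "{\<omega> \<in> F. x n \<omega> < C + 1} = F \<inter> {\<omega> \<in> space M. x n \<omega> < C + 1}"
          using F_sub by auto
        also have "\<dots> \<in> events"
          by (rule sets.Int[OF F_ev]) measurable
        finally show "{\<omega> \<in> F. x n \<omega> < C + 1} \<in> events" .
        show "FN N \<inter> E k \<subseteq> {\<omega> \<in> F. x n \<omega> < C + 1}"
        proof
          fix \<omega> assume \<omega>: "\<omega> \<in> FN N \<inter> E k"
          have "x n \<omega> \<le> exp (- \<eta>) ^ k * x m \<omega> + Y k \<omega>"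
            using path[of k \<omega>] \<omega> by (simp add: k(1) E_def)
          also have "exp (- \<eta>) ^ k * x m \<omega> \<le> exp (- \<eta>) ^ k * real N"
            using \<omega> by (intro mult_left_mono) (auto simp: FN_def)
          also have "\<dots> < 1" by (rule k0[OF k(2)])
          finally have "x n \<omega> < C + 1" using \<omega> by (simp add: E_def)
          then show "\<omega> \<in> {\<omega> \<in> F. x n \<omega> < C + 1}" using \<omega> by (simp add: FN_def)
        qed
      qed
      finally show "p0 / 4 * prob F \<le> prob {\<omega> \<in> F. x n \<omega> < C + 1}" .
    qed simp
  qed
qed

section \<open>Reaching a small level\<close>

text \<open>
  On this event a value of at most \<open>e * y\<close> at time \<open>n\<close> is followed by a value below \<open>e\<close>; for \<open>y = 0\<close>
  it is the event \<open>b n < e\<close>.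
\<close>

definition step_event :: "nat \<Rightarrow> real \<Rightarrow> real \<Rightarrow> 'a set" where
  "step_event n e y = {\<omega> \<in> space M. e * a n \<omega> * y + b n \<omega> < e}"

definition \<psi> :: "real \<Rightarrow> real \<Rightarrow> real" where
  "\<psi> e y = prob (step_event 0 e y)"

lemma step_event_\<F>: "n \<in> I \<Longrightarrow> step_event n e y \<in> sets (\<F> I)"
proof -
  assume "n \<in> I"
  note [measurable] = a_measurable_\<F>[OF this] b_measurable_\<F>[OF this]
  have "{\<omega> \<in> space (\<F> I). e * a n \<omega> * y + b n \<omega> < e} \<in> sets (\<F> I)" by measurable
  then show ?thesis by (simp add: step_event_def)
qed

lemma prob_step_event: "prob (step_event n e y) = \<psi> e y"
proof -
  have "Measurable.pred borel (\<lambda>p. e * fst p * y + snd p < e)"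
    unfolding borel_prod[symmetric] by measurable
  from prob_step[OF this, of n] show ?thesis by (simp add: step_event_def \<psi>_def)
qed

lemma less_if_step_event:
  assumes "\<omega> \<in> step_event n e y" and "x n \<omega> \<le> e * y"
  shows "x (Suc n) \<omega> < e"
proof -
  have "a n \<omega> * x n \<omega> \<le> a n \<omega> * (e * y)" using assms(2) a_nonneg by (rule mult_left_mono)
  with assms(1) show ?thesis by (simp add: step_event_def mult_ac)
qed

text \<open>
  For \<open>y > 1\<close> the same event makes the step a contraction: as both \<open>a\<close> and \<open>b\<close> are nonnegative, it
  forces \<open>a < 1 / y\<close> and \<open>b < e\<close>.
\<close>

lemma step_event_contract:
  assumes \<omega>: "\<omega> \<in> step_event n e y" and "x n \<omega> < u" and "e > 0" and "y > 0"
  shows "x (Suc n) \<omega> < u / y + e"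
proof -
  have 1: "e * a n \<omega> * y + b n \<omega> < e" using \<omega> by (simp add: step_event_def)
  then have "e * (a n \<omega> * y) < e * 1" using b_nonneg[of n \<omega>] by (simp add: mult.assoc)
  then have "a n \<omega> \<le> 1 / y" using \<open>e > 0\<close> \<open>y > 0\<close> by (simp add: field_simps)
  then have "a n \<omega> * x n \<omega> \<le> 1 / y * u"
    using assms(2) x_nonneg[of n \<omega>] \<open>y > 0\<close> by (intro mult_mono) auto
  moreover have "b n \<omega> < e"
  proof -
    have "0 \<le> e * a n \<omega> * y" using a_nonneg[of n \<omega>] \<open>e > 0\<close> \<open>y > 0\<close> by simp
    with 1 show ?thesis by linarith
  qed
  ultimately show ?thesis by simp
qed

lemma level_event_\<F>:
  assumes "F \<in> sets (\<F> {..<n})" and "k \<le> n"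
  shows "{\<omega> \<in> F. x k \<omega> < u} \<in> sets (\<F> {..<n})"
proof -
  note [measurable] = x_measurable_\<F>[OF assms(2)]
  have "{\<omega> \<in> space (\<F> {..<n}). x k \<omega> < u} \<in> sets (\<F> {..<n})" by measurable
  with assms(1) have "F \<inter> {\<omega> \<in> space (\<F> {..<n}). x k \<omega> < u} \<in> sets (\<F> {..<n})" by blast
  also have "F \<inter> {\<omega> \<in> space (\<F> {..<n}). x k \<omega> < u} = {\<omega> \<in> F. x k \<omega> < u}"
    using sets.sets_into_space[OF assms(1)] by auto
  finally show ?thesis .
qed

text \<open>
  Iterating the contraction \<open>u \<mapsto> u / y + e\<close>, whose fixed point is \<open>e * y / (y - 1)\<close>, leads from any
  level \<open>R\<close> below \<open>d\<close> in a fixed number of steps, at the price of a fixed factor.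
\<close>

lemma contraction_reaches:
  assumes "y > 1" and "e > 0" and "e * y / (y - 1) < d"
  shows "\<exists>r. \<forall>n. \<forall>F\<in>sets (\<F> {..<n}).
           prob {\<omega> \<in> F. x (n + r) \<omega> < d} \<ge> \<psi> e y ^ r * prob {\<omega> \<in> F. x n \<omega> < R}"
proof -
  have "(\<lambda>r. (1 / y) ^ r * R) \<longlonglongrightarrow> 0 * R"
    using \<open>y > 1\<close> by (intro tendsto_mult_right LIMSEQ_power_zero) auto
  then have "eventually (\<lambda>r. (1 / y) ^ r * R < d - e * y / (y - 1)) sequentially"
    using assms(3) by (intro order_tendstoD) auto
  then obtain r where r: "(1 / y) ^ r * R < d - e * y / (y - 1)"
    by (auto simp: eventually_sequentially)
  show ?thesis
  proof (intro exI[of _ r] allI ballI)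
    fix n F assume F: "F \<in> sets (\<F> {..<n})"
    have "\<exists>E\<in>sets (\<F> {..<n + i}). E \<subseteq> F \<and> prob E = \<psi> e y ^ i * prob {\<omega> \<in> F. x n \<omega> < R} \<and>
            (\<forall>\<omega>\<in>E. x (n + i) \<omega> < (1 / y) ^ i * R + e * y / (y - 1))" for i
    proof (induction i)
      case 0
      have "e * y / (y - 1) > 0" using assms(1,2) by simp
      then show ?case
        using level_event_\<F>[OF F order_refl, of R] by (intro bexI[of _ "{\<omega> \<in> F. x n \<omega> < R}"]) auto
    next
      case (Suc i)
      then obtain E where E: "E \<in> sets (\<F> {..<n + i})" "E \<subseteq> F"
        "prob E = \<psi> e y ^ i * prob {\<omega> \<in> F. x n \<omega> < R}"
        "\<And>\<omega>. \<omega> \<in> E \<Longrightarrow> x (n + i) \<omega> < (1 / y) ^ i * R + e * y / (y - 1)" by blast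
      let ?E = "E \<inter> step_event (n + i) e y"
      show ?case
      proof (rule bexI[of _ ?E], intro conjI ballI)
        show "?E \<subseteq> F" using E(2) by auto
        have "prob ?E = prob E * prob (step_event (n + i) e y)"
          by (rule indep_\<F>[OF E(1) step_event_\<F>[of _ "{n + i}"]]) auto
        then show "prob ?E = \<psi> e y ^ Suc i * prob {\<omega> \<in> F. x n \<omega> < R}"
          by (simp add: E(3) prob_step_event mult_ac)
        show "?E \<in> sets (\<F> {..<n + Suc i})"
          using sets_\<F>_mono[of "{..<n + i}" "{..<n + Suc i}"] E(1)
          by (intro sets.Int step_event_\<F>) auto
        fix \<omega> assume "\<omega> \<in> ?E"
        then have "x (Suc (n + i)) \<omega> < ((1 / y) ^ i * R + e * y / (y - 1)) / y + e"
          using assms(1,2) by (intro step_event_contract E(4)) auto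
        also have "\<dots> = (1 / y) ^ Suc i * R + e * y / (y - 1)"
          using assms(1) by (simp add: field_simps)
        finally show "x (n + Suc i) \<omega> < (1 / y) ^ Suc i * R + e * y / (y - 1)" by simp
      qed
    qed
    from this[of r] obtain E where E: "E \<in> sets (\<F> {..<n + r})" "E \<subseteq> F"
        "prob E = \<psi> e y ^ r * prob {\<omega> \<in> F. x n \<omega> < R}"
        "\<And>\<omega>. \<omega> \<in> E \<Longrightarrow> x (n + r) \<omega> < (1 / y) ^ r * R + e * y / (y - 1)" by blast
    have F': "F \<in> sets (\<F> {..<n + r})"
      using sets_\<F>_mono[of "{..<n}" "{..<n + r}"] F by auto
    have "prob E \<le> prob {\<omega> \<in> F. x (n + r) \<omega> < d}"
    proof (rule finite_measure_mono)
      show "E \<subseteq> {\<omega> \<in> F. x (n + r) \<omega> < d}"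
      proof
        fix \<omega> assume "\<omega> \<in> E"
        then show "\<omega> \<in> {\<omega> \<in> F. x (n + r) \<omega> < d}" using E(2) E(4)[of \<omega>] r by auto
      qed
      show "{\<omega> \<in> F. x (n + r) \<omega> < d} \<in> events"
        by (rule sets_\<F>_events[OF level_event_\<F>[OF F' order_refl]])
    qed
    then show "prob {\<omega> \<in> F. x (n + r) \<omega> < d} \<ge> \<psi> e y ^ r * prob {\<omega> \<in> F. x n \<omega> < R}"
      by (simp add: E(3))
  qed
qed

lemma prob_successive:
  assumes "\<And>i. E i \<in> sets (\<F> {n + i})"
  shows "{\<omega> \<in> space M. \<forall>i<K. \<omega> \<in> E i} \<in> sets (\<F> {n..<n + K})"
    and "prob {\<omega> \<in> space M. \<forall>i<K. \<omega> \<in> E i} = (\<Prod>i<K. prob (E i))"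
proof -
  define P where "P K = {\<omega> \<in> space M. \<forall>i<K. \<omega> \<in> E i}" for K
  have P_Suc: "P (Suc K) = P K \<inter> E K" for K
    using sets.sets_into_space[OF assms[of K]] by (auto simp: P_def less_Suc_eq)
  have *: "P K \<in> sets (\<F> {n..<n + K}) \<and> prob (P K) = (\<Prod>i<K. prob (E i))"
  proof (induction K)
    case 0
    have "space (\<F> {}) \<in> sets (\<F> {})" by (rule sets.top)
    then show ?case by (simp add: P_def prob_space)
  next
    case (Suc K)
    have "prob (P K \<inter> E K) = prob (P K) * prob (E K)"
      using Suc assms[of K] by (intro indep_\<F>[of _ "{n..<n + K}" _ "{n + K}"]) auto
    moreover have "P K \<inter> E K \<in> sets (\<F> {n..<n + Suc K})"
      using Suc assms[of K] sets_\<F>_mono[of "{n..<n + K}" "{n..<n + Suc K}"]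
        sets_\<F>_mono[of "{n + K}" "{n..<n + Suc K}"] by (intro sets.Int) auto
    ultimately show ?case using Suc by (simp add: P_Suc)
  qed
  from * show "{\<omega> \<in> space M. \<forall>i<K. \<omega> \<in> E i} \<in> sets (\<F> {n..<n + K})"
    and "prob {\<omega> \<in> space M. \<forall>i<K. \<omega> \<in> E i} = (\<Prod>i<K. prob (E i))"
    unfolding P_def by blast+
qed

text \<open>
  The successive thresholds are \<open>e * y ^ (K - 1)\<close>, \<open>\<dots>\<close>, \<open>e * y\<close>, \<open>e\<close>. The event depends on the pairs
  from time \<open>n\<close> on only and does not mention the value of the recursion at time \<open>n\<close>.
\<close>

definition descent :: "nat \<Rightarrow> nat \<Rightarrow> real \<Rightarrow> real \<Rightarrow> 'a set" where
  "descent n K e y = {\<omega> \<in> space M. \<forall>i<K. \<omega> \<in> step_event (n + i) (e * y ^ (K - Suc i)) y}"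

lemma descent_\<F>: "descent n K e y \<in> sets (\<F> {n..<n + K})"
  unfolding descent_def by (rule prob_successive(1)) (rule step_event_\<F>, simp)

lemma prob_descent: "prob (descent n K e y) = (\<Prod>k<K. \<psi> (e * y ^ k) y)"
proof -
  have "prob (descent n K e y) = (\<Prod>i<K. prob (step_event (n + i) (e * y ^ (K - Suc i)) y))"
    unfolding descent_def by (rule prob_successive(2)[where n = n]) (rule step_event_\<F>, simp)
  also have "\<dots> = (\<Prod>i<K. \<psi> (e * y ^ (K - Suc i)) y)" by (simp add: prob_step_event)
  also have "\<dots> = (\<Prod>k<K. \<psi> (e * y ^ k) y)" by (rule prod.nat_diff_reindex)
  finally show ?thesis .
qed

lemma descent_reaches:
  assumes \<omega>: "\<omega> \<in> descent n K e y" and "x n \<omega> < e * y ^ K"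
  shows "x (n + K) \<omega> < e"
proof -
  have "x (n + i) \<omega> < e * y ^ (K - i)" if "i \<le> K" for i
    using that
  proof (induction i)
    case (Suc i)
    define j where "j = K - Suc i"
    have j: "K - i = Suc j" using Suc.prems unfolding j_def by linarith
    have "x (n + i) \<omega> < e * y ^ (K - i)" by (rule Suc.IH) (use Suc.prems in linarith)
    then have "x (n + i) \<omega> \<le> e * y ^ (K - Suc i) * y"
      unfolding j j_def[symmetric] by (simp add: mult_ac)
    moreover have "\<omega> \<in> step_event (n + i) (e * y ^ (K - Suc i)) y"
      using \<omega> Suc.prems by (auto simp: descent_def)
    ultimately have "x (Suc (n + i)) \<omega> < e * y ^ (K - Suc i)" by (rule less_if_step_event[rotated])
    then show ?case by (simp only: add_Suc_right)
  next
    case 0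
    show ?case using assms(2) by simp
  qed
  from this[of K] show ?thesis by simp
qed

section \<open>The lower tail of the recursion\<close>

text \<open>
  A rate for the decay of the lower tail, uniform over all times from \<open>m\<close> on. Since the recursion
  starts at 0, larger rates need larger \<open>m\<close>.
\<close>

definition lower_tail_rate :: "(real \<Rightarrow> real) \<Rightarrow> nat \<Rightarrow> real \<Rightarrow> bool" where
  "lower_tail_rate H m l \<longleftrightarrow> (\<forall>u<l. eventually (\<lambda>e. \<forall>n\<ge>m.
     prob {\<omega> \<in> space M. x n \<omega> < e} \<le> exp (- (u * H e))) (at_right 0))"

text \<open>
  The converse of \<open>less_if_step_event\<close>: a step from at least \<open>e * t\<close> to below \<open>e\<close> is expensive.
\<close>

lemma step_event_if_less:
  assumes "e * t \<le> x n \<omega>" and "x (Suc n) \<omega> < e" and "\<omega> \<in> space M"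
  shows "\<omega> \<in> step_event n e t"
proof -
  have "a n \<omega> * (e * t) \<le> a n \<omega> * x n \<omega>" using assms(1) a_nonneg by (rule mult_left_mono)
  then show ?thesis using assms(2,3) by (simp add: step_event_def mult_ac)
qed

lemma \<psi>_antimono: "0 \<le> s \<Longrightarrow> s \<le> t \<Longrightarrow> e \<ge> 0 \<Longrightarrow> \<psi> e t \<le> \<psi> e s"
  unfolding \<psi>_def
proof (rule finite_measure_mono)
  assume st: "0 \<le> s" "s \<le> t" "e \<ge> 0"
  show "step_event 0 e t \<subseteq> step_event 0 e s"
  proof
    fix \<omega> assume \<omega>: "\<omega> \<in> step_event 0 e t"
    have "e * a 0 \<omega> * s \<le> e * a 0 \<omega> * t"
      by (rule mult_left_mono) (use st a_nonneg[of 0 \<omega>] in simp_all)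
    with \<omega> show "\<omega> \<in> step_event 0 e s" by (simp add: step_event_def)
  qed
  show "step_event 0 e s \<in> events" by (rule sets_\<F>_events[OF step_event_\<F>[of 0 "{0}"]]) simp
qed

text \<open>
  Distinguish whether the previous value is below \<open>e\<close>, in one of the cells from \<open>r ^ j * e\<close> to
  \<open>r ^ Suc j * e\<close>, or beyond \<open>r ^ J * e\<close>. In each case the upper end of the cell bounds the
  probability of the previous value, and its lower end bounds that of the step.
\<close>

lemma lower_tail_recursion:
  assumes "e > 0" and "r > 1"
  shows "prob {\<omega> \<in> space M. x (Suc n) \<omega> < e} \<le>
           prob {\<omega> \<in> space M. x n \<omega> < e} * \<psi> e 0 +
           (\<Sum>j<J. prob {\<omega> \<in> space M. x n \<omega> < r ^ Suc j * e} * \<psi> e (r ^ j)) + \<psi> e (r ^ J)"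
proof -
  define L where "L u = {\<omega> \<in> space M. x n \<omega> < u}" for u
  have top: "space M \<in> sets (\<F> {..<n})" using sets.top[of "\<F> {..<n}"] by simp
  have L_\<F>: "L u \<in> sets (\<F> {..<n})" for u
    unfolding L_def by (rule level_event_\<F>[OF top order_refl])
  have S_\<F>: "step_event n e t \<in> sets (\<F> {n})" for t by (rule step_event_\<F>) simp
  note ev = sets_\<F>_events[OF L_\<F>] sets_\<F>_events[OF S_\<F>]
  have prob_LS: "prob (L u \<inter> step_event n e t) = prob (L u) * \<psi> e t" for u t
    using indep_\<F>[OF L_\<F> S_\<F>] by (simp add: prob_step_event)
  let ?U = "(L e \<inter> step_event n e 0) \<union> (\<Union>j<J. L (r ^ Suc j * e) \<inter> step_event n e (r ^ j))"
  have sub: "{\<omega> \<in> space M. x (Suc n) \<omega> < e} \<subseteq> ?U \<union> step_event n e (r ^ J)"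
  proof
    fix \<omega> assume "\<omega> \<in> {\<omega> \<in> space M. x (Suc n) \<omega> < e}"
    then have \<omega>: "\<omega> \<in> space M" "x (Suc n) \<omega> < e" by auto
    have S: "\<omega> \<in> step_event n e t" if "e * t \<le> x n \<omega>" for t
      using step_event_if_less[OF that \<omega>(2,1)] .
    show "\<omega> \<in> ?U \<union> step_event n e (r ^ J)"
    proof (cases "x n \<omega> < r ^ J * e")
      case False
      then show ?thesis using S[of "r ^ J"] by (simp add: mult.commute)
    next
      case True
      define j where "j = (LEAST j. x n \<omega> < r ^ j * e)"
      have j: "x n \<omega> < r ^ j * e" unfolding j_def using True by (rule LeastI)
      have "j \<le> J" unfolding j_def using True by (rule Least_le)
      show ?thesis
      proof (cases j)
        case 0
        then have "\<omega> \<in> L e" using j \<omega> by (simp add: L_def)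
        then show ?thesis using S[of 0] x_nonneg by simp
      next
        case (Suc i)
        then have "\<not> x n \<omega> < r ^ i * e" using not_less_Least[of i "\<lambda>j. x n \<omega> < r ^ j * e"] by (simp add: j_def)
        then have "\<omega> \<in> step_event n e (r ^ i)" by (intro S) (simp add: mult.commute)
        moreover have "\<omega> \<in> L (r ^ Suc i * e)" using j Suc \<omega> by (simp add: L_def)
        moreover have "i \<in> {..<J}" using Suc \<open>j \<le> J\<close> by simp
        ultimately show ?thesis by (intro UnI1 UnI2 UN_I[of i] IntI)
      qed
    qed
  qed
  have "prob {\<omega> \<in> space M. x (Suc n) \<omega> < e} \<le> prob (?U \<union> step_event n e (r ^ J))"
    by (rule finite_measure_mono[OF sub]) (use ev in auto)
  also have "\<dots> \<le> prob ?U + prob (step_event n e (r ^ J))"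
    by (rule measure_Un_le) (use ev in auto)
  also have "prob ?U \<le> prob (L e \<inter> step_event n e 0) +
      prob (\<Union>j<J. L (r ^ Suc j * e) \<inter> step_event n e (r ^ j))"
    by (rule measure_Un_le) (use ev in auto)
  also have "prob (\<Union>j<J. L (r ^ Suc j * e) \<inter> step_event n e (r ^ j)) \<le>
      (\<Sum>j<J. prob (L (r ^ Suc j * e) \<inter> step_event n e (r ^ j)))"
    by (rule finite_measure_subadditive_finite) (use ev in auto)
  finally show ?thesis
    by (simp add: prob_LS prob_step_event) (simp add: L_def)
qed

lemma lower_tail_rate_scale:
  assumes rv: "regularly_varying_at_0 \<rho> H" and rate: "lower_tail_rate H m l"
    and "t > 0" and u: "u < l * t powr (-\<rho>)"
  shows "eventually (\<lambda>e. \<forall>n\<ge>m. prob {\<omega> \<in> space M. x n \<omega> < t * e} \<le> exp (- (u * H e))) (at_right 0)"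
proof -
  have tp: "t powr (-\<rho>) > 0" using \<open>t > 0\<close> by simp
  then have "u / t powr (-\<rho>) < l" using u by (simp add: pos_divide_less_eq)
  then obtain l' where l': "u / t powr (-\<rho>) < l'" "l' < l" using dense by blast
  have "eventually (\<lambda>e. \<forall>n\<ge>m. prob {\<omega> \<in> space M. x n \<omega> < e} \<le> exp (- (l' * H e))) (at_right 0)"
    using rate l'(2) by (simp add: lower_tail_rate_def)
  from eventually_at_right_0_scale[OF \<open>t > 0\<close> this]
  have 1: "eventually (\<lambda>e. \<forall>n\<ge>m. prob {\<omega> \<in> space M. x n \<omega> < t * e} \<le> exp (- (l' * H (t * e)))) (at_right 0)" .
  have "((\<lambda>e. l' * (H (t * e) / H e)) \<longlongrightarrow> l' * t powr (-\<rho>)) (at_right 0)"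
    using rv \<open>t > 0\<close> by (intro tendsto_mult_left) (simp add: regularly_varying_at_0_def)
  moreover have "u < l' * t powr (-\<rho>)" using l'(1) tp by (simp add: pos_divide_less_eq)
  ultimately have 2: "eventually (\<lambda>e. u < l' * (H (t * e) / H e)) (at_right 0)"
    by (rule order_tendstoD)
  have 3: "eventually (\<lambda>e::real. e > 0) (at_right 0)" by (rule eventually_at_right_less)
  from 1 2 3 show ?thesis
  proof eventually_elim
    case (elim e)
    have "u * H e \<le> l' * H (t * e)"
      using elim(2) rv_pos[OF rv elim(3)] by (simp add: pos_less_divide_eq)
    then have "exp (- (l' * H (t * e))) \<le> exp (- (u * H e))" by simp
    then show ?case using elim(1) order_trans by blast
  qed
qed

text \<open>
  If the previous value is near \<open>t * e\<close> and \<open>v = t powr (-\<rho>)\<close>, the exponent of the corresponding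
  term in \<open>lower_tail_recursion\<close> is \<open>l * v\<close> for the previous value plus at least
  \<open>max gam (lam * (1 - v))\<close> for the step. Replacing the maximum by the convex combination with
  weights \<open>1 - l / lam\<close> and \<open>l / lam\<close> cancels \<open>v\<close> and leaves \<open>gam + l * (1 - gam / lam)\<close>. The finite
  width of the cells, the cut-off at \<open>r ^ J\<close> and the number of terms only cost an arbitrarily small
  part \<open>s\<close> of the rate.
\<close>

lemma lower_tail_rate_step:
  assumes rv: "regularly_varying_at_0 \<rho> H" and "\<rho> > 0" and gam: "0 < gam" "gam \<le> lam"
    and \<psi>0: "\<And>u. u < gam \<Longrightarrow> eventually (\<lambda>e. \<psi> e 0 \<le> exp (- (u * H e))) (at_right 0)"
    and \<psi>1: "\<And>t u. t \<ge> 1 \<Longrightarrow> u < lam * (1 - t powr (-\<rho>)) \<Longrightarrow>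
      eventually (\<lambda>e. \<psi> e t \<le> exp (- (u * H e))) (at_right 0)"
    and l: "0 \<le> l" "l \<le> lam" and rate: "lower_tail_rate H m l"
  shows "lower_tail_rate H (Suc m) (gam + l * (1 - gam / lam))"
  unfolding lower_tail_rate_def
proof (intro allI impI)
  define \<tau> where "\<tau> = gam + l * (1 - gam / lam)"
  fix u assume "u < gam + l * (1 - gam / lam)"
  define s where "s = \<tau> - u"
  have s: "s > 0" using \<open>u < _\<close> by (simp add: s_def \<tau>_def)
  have lam: "lam > 0" using gam by simp
  \<comment> \<open>The ratio \<open>r\<close> of the cells is chosen such that \<open>r powr (-\<rho>) = w\<close> with \<open>lam * (1 - w) < s / 4\<close>.\<close>
  define \<sigma> where "\<sigma> = s / (4 * lam)"
  have \<sigma>: "\<sigma> > 0" using s lam by (simp add: \<sigma>_def)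
  define r where "r = (1 + \<sigma>) powr (1 / \<rho>)"
  define w where "w = 1 / (1 + \<sigma>)"
  have r: "r > 1" using \<sigma> \<open>\<rho> > 0\<close> by (simp add: r_def gr_one_powr)
  have w: "0 < w" "w < 1" using \<sigma> by (auto simp: w_def)
  have rw: "(r ^ j) powr (-\<rho>) = w ^ j" for j
  proof -
    have "r powr (-\<rho>) = w"
      using \<sigma> \<open>\<rho> > 0\<close> by (simp add: r_def w_def powr_powr powr_minus_divide)
    then show ?thesis using r by (induction j) (simp_all add: powr_mult)
  qed
  have lw: "lam * (1 - w) < s / 4"
  proof -
    have "1 - w < \<sigma>" using \<sigma> by (simp add: w_def field_simps)
    then have "lam * (1 - w) < lam * \<sigma>" using lam by simp
    then show ?thesis using lam by (simp add: \<sigma>_def)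
  qed
  have "(\<lambda>J. lam * w ^ J) \<longlonglongrightarrow> lam * 0"
    using w by (intro tendsto_mult_left LIMSEQ_power_zero) auto
  then have "eventually (\<lambda>J. lam * w ^ J < s / 4) sequentially"
    using s by (intro order_tendstoD) auto
  then obtain J where J: "lam * w ^ J < s / 4" by (auto simp: eventually_sequentially)
  have key: "\<tau> \<le> l * v + max gam (lam * (1 - v))" for v
  proof -
    let ?\<theta> = "l / lam"
    have \<theta>: "0 \<le> ?\<theta>" "?\<theta> \<le> 1" using l lam by auto
    have "(1 - ?\<theta>) * gam + ?\<theta> * (lam * (1 - v)) \<le>
        (1 - ?\<theta>) * max gam (lam * (1 - v)) + ?\<theta> * max gam (lam * (1 - v))"
      using \<theta> by (intro add_mono mult_left_mono) auto
    also have "\<dots> = max gam (lam * (1 - v))" by (simp add: algebra_simps)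
    finally have "(1 - ?\<theta>) * gam + ?\<theta> * (lam * (1 - v)) \<le> max gam (lam * (1 - v))" .
    moreover have "(1 - ?\<theta>) * gam + ?\<theta> * (lam * (1 - v)) = \<tau> - l * v"
      using lam by (simp add: \<tau>_def field_simps)
    ultimately show ?thesis by linarith
  qed
  have \<tau>_le: "\<tau> \<le> l + gam" using l gam lam by (simp add: \<tau>_def algebra_simps)
  have \<tau>_lam: "\<tau> \<le> lam"
  proof -
    have "l * (1 - gam / lam) \<le> lam * (1 - gam / lam)"
      using l gam lam by (intro mult_right_mono) auto
    then show ?thesis using lam by (simp add: \<tau>_def algebra_simps)
  qed
  have pos: "eventually (\<lambda>e::real. e > 0) (at_right 0)" by (rule eventually_at_right_less)
  have A: "eventually (\<lambda>e. \<forall>n\<ge>m. prob {\<omega> \<in> space M. x n \<omega> < e} \<le> exp (- ((l - s / 4) * H e))) (at_right 0)"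
    using rate s by (simp add: lower_tail_rate_def)
  have A0: "eventually (\<lambda>e. \<psi> e 0 \<le> exp (- ((gam - s / 4) * H e))) (at_right 0)"
    using s by (intro \<psi>0) auto
  have B: "eventually (\<lambda>e. \<forall>j\<in>{..<J}. \<forall>n\<ge>m. prob {\<omega> \<in> space M. x n \<omega> < r ^ Suc j * e}
      \<le> exp (- ((l * w ^ Suc j - s / 8) * H e))) (at_right 0)"
  proof (intro eventually_ball_finite ballI finite_lessThan)
    fix j
    show "eventually (\<lambda>e. \<forall>n\<ge>m. prob {\<omega> \<in> space M. x n \<omega> < r ^ Suc j * e}
      \<le> exp (- ((l * w ^ Suc j - s / 8) * H e))) (at_right 0)"
      using r s rw[of "Suc j"] by (intro lower_tail_rate_scale[OF rv rate]) (auto simp del: power_Suc)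
  qed
  have B0: "eventually (\<lambda>e. \<forall>j\<in>{..<J}. \<psi> e (r ^ j) \<le> exp (- ((max gam (lam * (1 - w ^ j)) - s / 8) * H e))) (at_right 0)"
  proof (intro eventually_ball_finite ballI finite_lessThan)
    fix j
    have rj: "r ^ j \<ge> 1" using r by simp
    show "eventually (\<lambda>e. \<psi> e (r ^ j) \<le> exp (- ((max gam (lam * (1 - w ^ j)) - s / 8) * H e))) (at_right 0)"
    proof (cases "gam \<le> lam * (1 - w ^ j)")
      case True
      then show ?thesis using s rw[of j] by (intro \<psi>1 rj) (auto simp: max_def)
    next
      case False
      then have "eventually (\<lambda>e. \<psi> e 0 \<le> exp (- ((max gam (lam * (1 - w ^ j)) - s / 8) * H e))) (at_right 0)"
        using s by (intro \<psi>0) (auto simp: max_def)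
      with pos show ?thesis
      proof eventually_elim
        case (elim e)
        then have "\<psi> e (r ^ j) \<le> \<psi> e 0" using rj by (intro \<psi>_antimono) auto
        with elim show ?case by linarith
      qed
    qed
  qed
  have C: "eventually (\<lambda>e. \<psi> e (r ^ J) \<le> exp (- ((lam * (1 - w ^ J) - s / 4) * H e))) (at_right 0)"
    using r s rw[of J] by (intro \<psi>1) auto
  have "eventually (\<lambda>e. ln (real J + 2) / (s / 2) \<le> H e) (at_right 0)"
    using rv_at_top[OF rv \<open>\<rho> > 0\<close>] by (simp add: filterlim_at_top)
  with pos A A0 B B0 C
  show "eventually (\<lambda>e. \<forall>n\<ge>Suc m. prob {\<omega> \<in> space M. x n \<omega> < e} \<le> exp (- (u * H e))) (at_right 0)"
  proof eventually_elim
    case (elim e)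
    note Hpos = rv_pos[OF rv \<open>0 < e\<close>]
    define X where "X = exp (- ((\<tau> - s / 2) * H e))"
    have le_X: "exp (- (v * H e)) \<le> X" if "\<tau> - s / 2 \<le> v" for v
      unfolding X_def using that Hpos by (simp add: mult_right_mono)
    show ?case
    proof (intro allI impI)
      fix n assume "Suc m \<le> n"
      then obtain k where n: "n = Suc k" and k: "m \<le> k" by (cases n) auto
      have 1: "prob {\<omega> \<in> space M. x k \<omega> < e} * \<psi> e 0 \<le> X"
      proof -
        have "prob {\<omega> \<in> space M. x k \<omega> < e} * \<psi> e 0
            \<le> exp (- ((l - s / 4) * H e)) * exp (- ((gam - s / 4) * H e))"
          using elim k by (intro mult_mono) (auto simp: \<psi>_def)
        also have "\<dots> = exp (- ((l + gam - s / 2) * H e))"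
          by (simp add: algebra_simps flip: exp_add)
        also have "\<dots> \<le> X" using \<tau>_le by (intro le_X) simp
        finally show ?thesis .
      qed
      have 2: "prob {\<omega> \<in> space M. x k \<omega> < r ^ Suc j * e} * \<psi> e (r ^ j) \<le> X" if "j < J" for j
      proof -
        have "prob {\<omega> \<in> space M. x k \<omega> < r ^ Suc j * e} * \<psi> e (r ^ j)
            \<le> exp (- ((l * w ^ Suc j - s / 8) * H e)) * exp (- ((max gam (lam * (1 - w ^ j)) - s / 8) * H e))"
          using elim k that by (intro mult_mono) (auto simp: \<psi>_def simp del: power_Suc)
        also have "\<dots> = exp (- ((l * w ^ Suc j + max gam (lam * (1 - w ^ j)) - s / 4) * H e))"
          by (simp add: algebra_simps flip: exp_add)
        also have "\<dots> \<le> X"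
        proof (rule le_X)
          have "l * w ^ j * (1 - w) \<le> lam * 1 * (1 - w)"
            using l w lam by (intro mult_mono power_le_one) auto
          then have "l * w ^ j - l * w ^ Suc j \<le> s / 4" using lw by (simp add: algebra_simps)
          then show "\<tau> - s / 2 \<le> l * w ^ Suc j + max gam (lam * (1 - w ^ j)) - s / 4"
            using key[of "w ^ j"] by linarith
        qed
        finally show ?thesis .
      qed
      have 3: "\<psi> e (r ^ J) \<le> X"
      proof -
        have "\<tau> - s / 2 \<le> lam * (1 - w ^ J) - s / 4"
          using J \<tau>_lam by (simp add: algebra_simps)
        from le_X[OF this] elim show ?thesis by simp
      qed
      have "prob {\<omega> \<in> space M. x n \<omega> < e} \<le> X + (\<Sum>j<J. X) + X"
        unfolding n using 1 2 3
        by (intro order_trans[OF lower_tail_recursion[OF \<open>0 < e\<close> r, of k J]] add_mono sum_mono) auto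
      also have "\<dots> = (real J + 2) * X" by (simp add: algebra_simps)
      also have "\<dots> = exp (ln (real J + 2)) * X" by (subst exp_ln) auto
      also have "\<dots> \<le> exp (s / 2 * H e) * X"
      proof (rule mult_right_mono)
        show "exp (ln (real J + 2)) \<le> exp (s / 2 * H e)"
          using elim s by (simp only: exp_le_cancel_iff) (simp add: field_simps)
        show "0 \<le> X" by (simp add: X_def)
      qed
      also have "\<dots> = exp (- (u * H e))"
        unfolding X_def s_def by (simp add: field_simps flip: exp_add)
      finally show "prob {\<omega> \<in> space M. x n \<omega> < e} \<le> exp (- (u * H e))" .
    qed
  qed
qed

text \<open>
  The trivial rate 0 holds at time 0. Iterating \<open>lower_tail_rate_step\<close> gives the rates
  \<open>lam * (1 - q ^ k)\<close> with \<open>q = 1 - gam / lam < 1\<close>, which exceed \<open>c powr \<rho>\<close> eventually; then the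
  probabilities are summable.
\<close>

lemma AE_eventually_ge:
  assumes rv: "regularly_varying_at_0 \<rho> H" and "\<rho> > 0" and gam: "0 < gam" "gam \<le> lam"
    and \<psi>0: "\<And>u. u < gam \<Longrightarrow> eventually (\<lambda>e. \<psi> e 0 \<le> exp (- (u * H e))) (at_right 0)"
    and \<psi>1: "\<And>t u. t \<ge> 1 \<Longrightarrow> u < lam * (1 - t powr (-\<rho>)) \<Longrightarrow>
      eventually (\<lambda>e. \<psi> e t \<le> exp (- (u * H e))) (at_right 0)"
    and c: "c > 0" "c powr \<rho> < lam"
  shows "AE \<omega> in M. eventually (\<lambda>n. c * gen_inverse H (ln (real n)) \<le> x n \<omega>) sequentially"
proof -
  define q where "q = 1 - gam / lam"
  have lam: "lam > 0" using gam by simp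
  have q: "0 \<le> q" "q < 1" using gam lam by (auto simp: q_def)
  have rate: "lower_tail_rate H k (lam * (1 - q ^ k))" for k
  proof (induction k)
    case 0
    show ?case unfolding lower_tail_rate_def
    proof (intro allI impI)
      fix u :: real assume "u < lam * (1 - q ^ 0)"
      then have u: "u < 0" by simp
      have "eventually (\<lambda>e::real. e > 0) (at_right 0)" by (rule eventually_at_right_less)
      then show "eventually (\<lambda>e. \<forall>n\<ge>0. prob {\<omega> \<in> space M. x n \<omega> < e} \<le> exp (- (u * H e))) (at_right 0)"
      proof eventually_elim
        case (elim e)
        have "1 \<le> exp (- (u * H e))" using u rv_pos[OF rv elim] by (simp add: mult_neg_pos less_imp_le)
        then show ?case using prob_le_1 order_trans by blast
      qed
    qed
  next
    case (Suc k)
    have "q ^ k \<le> 1" "q ^ k \<ge> 0" using q by (auto intro: power_le_one)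
    then have "lower_tail_rate H (Suc k) (gam + lam * (1 - q ^ k) * (1 - gam / lam))"
      using lam by (intro lower_tail_rate_step[OF rv \<open>\<rho> > 0\<close> gam \<psi>0 \<psi>1 _ _ Suc]) auto
    also have "gam + lam * (1 - q ^ k) * (1 - gam / lam) = lam * (1 - q ^ Suc k)"
      using lam by (simp add: q_def[symmetric]) (simp add: q_def field_simps)
    finally show ?case .
  qed
  have "(\<lambda>k. lam * (1 - q ^ k)) \<longlonglongrightarrow> lam * (1 - 0)"
    using q by (intro tendsto_intros LIMSEQ_power_zero) auto
  then have "eventually (\<lambda>k. c powr \<rho> < lam * (1 - q ^ k)) sequentially"
    using c(2) by (intro order_tendstoD) auto
  then obtain k where k: "c powr \<rho> < lam * (1 - q ^ k)" by (auto simp: eventually_sequentially)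
  then obtain l where l: "c powr \<rho> < l" "l < lam * (1 - q ^ k)" using dense by blast
  have cp: "c powr \<rho> > 0" using c by simp
  then have l0: "l > 0" using l by linarith
  have "1 / l < c powr (-\<rho>)" using l cp l0 by (simp add: powr_minus field_simps)
  then obtain u where u: "1 / l < u" "u < c powr (-\<rho>)" using dense by blast
  have lu: "l * u > 1" using u(1) l0 by (simp add: field_simps)
  define e where "e n = c * gen_inverse H (ln (real n))" for n
  define A where "A n = {\<omega> \<in> space M. x n \<omega> < e n}" for n
  have "eventually (\<lambda>e. \<forall>n\<ge>k. prob {\<omega> \<in> space M. x n \<omega> < e} \<le> exp (- (l * H e))) (at_right 0)"
    using rate[of k] l by (simp add: lower_tail_rate_def)
  from eventually_compose_filterlim[OF this rv_gen_inverse_ln_tendsto[OF rv \<open>\<rho> > 0\<close> c(1)]]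
  have "eventually (\<lambda>n. \<forall>n'\<ge>k. prob {\<omega> \<in> space M. x n' \<omega> < e n} \<le> exp (- (l * H (e n)))) sequentially"
    by (simp add: e_def)
  moreover have "eventually (\<lambda>n. u * ln (real n) < H (e n)) sequentially"
    unfolding e_def by (rule rv_gen_inverse_ln_greater[OF rv \<open>\<rho> > 0\<close> c(1) u(2)])
  moreover have "eventually (\<lambda>n. n \<ge> max k 1) sequentially" by (rule eventually_ge_at_top)
  ultimately have bound: "eventually (\<lambda>n. norm (prob (A n)) \<le> real n powr (- (l * u))) sequentially"
  proof eventually_elim
    case (elim n)
    have "prob (A n) \<le> exp (- (l * H (e n)))" using elim by (simp add: A_def)
    also have "\<dots> \<le> exp (- (l * (u * ln (real n))))" using elim l0 by simp
    also have "\<dots> = real n powr (- (l * u))" using elim by (simp add: powr_def mult_ac)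
    finally show ?case by simp
  qed
  have "summable (\<lambda>n. real n powr (- (l * u)))" using lu by (simp add: summable_real_powr_iff)
  then have "summable (\<lambda>n. prob (A n))" by (rule summable_comparison_test_ev[OF bound])
  then have "AE \<omega> in M. eventually (\<lambda>n. \<omega> \<in> space M - A n) sequentially"
    by (intro borel_cantelli_AE1) (auto simp: A_def less_top[symmetric])
  then show ?thesis
    by (rule AE_mp) (auto intro!: AE_I2 elim!: eventually_mono simp: A_def e_def not_less)
qed

section \<open>Small values occur infinitely often\<close>

text \<open>
  The attempt \<open>j\<close> succeeds if \<open>D j\<close> (the start is favourable, an event of the past) and \<open>G j\<close> (an
  independent event in the block between \<open>s j\<close> and \<open>s (Suc j)\<close>) both occur. Splitting according to the
  last \<open>G j\<close> that occurs, the start of this attempt is independent of the choice of \<open>j\<close>, so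
  dependence among the \<open>D j\<close> is harmless: the probability of a success is at least \<open>p\<close> times that of
  some \<open>G j\<close>. As an induction on \<open>J\<close>, the bound satisfies \<open>v (J + 1) \<ge> p * g + (1 - g) * v J\<close>.
\<close>

lemma prob_some_success:
  assumes "mono s"
    and D: "\<And>j. D j \<in> sets (\<F> {..<s j})" and D_ge: "\<And>j. prob (D j) \<ge> p"
    and G: "\<And>j. G j \<in> sets (\<F> {s j..<s (Suc j)})" and G_eq: "\<And>j. prob (G j) = g"
  shows "prob (\<Union>j<J. D j \<inter> G j) \<ge> p * (1 - (1 - g) ^ J)"
proof -
  define V where "V J = (\<Union>j<J. D j \<inter> G j)" for J
  have g: "0 \<le> g" "g \<le> 1" using G_eq[of 0] by auto
  have s: "s i \<le> s j" if "i \<le> j" for i j using \<open>mono s\<close> that by (rule monoD)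
  have V_\<F>: "V J \<in> sets (\<F> {..<s J})" for J
    unfolding V_def
  proof (intro sets.finite_UN sets.Int)
    fix j assume "j \<in> {..<J}"
    then have "s j \<le> s J" "s (Suc j) \<le> s J" by (auto intro!: s)
    then have "{..<s j} \<subseteq> {..<s J}" "{s j..<s (Suc j)} \<subseteq> {..<s J}" by auto
    from this[THEN sets_\<F>_mono] show "D j \<in> sets (\<F> {..<s J})" "G j \<in> sets (\<F> {..<s J})"
      using D[of j] G[of j] by auto
  qed simp
  have "prob (V J) \<ge> p * (1 - (1 - g) ^ J)"
  proof (induction J)
    case (Suc J)
    have ev: "D J \<in> events" "G J \<in> events" "V J \<in> events"
      using sets_\<F>_events D G V_\<F> by blast+
    have disj: "{..<s J} \<inter> {s J..<s (Suc J)} = {}" by auto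
    have "prob (V J - G J) = prob (V J) - prob (V J \<inter> G J)"
      using ev by (simp add: finite_measure_Diff')
    also have "prob (V J \<inter> G J) = prob (V J) * g"
      using indep_\<F>[OF V_\<F> G disj] by (simp add: G_eq)
    finally have 1: "prob (V J - G J) = prob (V J) * (1 - g)" by (simp add: algebra_simps)
    have 2: "prob (D J \<inter> G J) = prob (D J) * g"
      using indep_\<F>[OF D G disj] by (simp add: G_eq)
    have "p * (1 - (1 - g) ^ Suc J) = p * g + (1 - g) * (p * (1 - (1 - g) ^ J))"
      by (simp add: algebra_simps)
    also have "\<dots> \<le> prob (D J) * g + (1 - g) * prob (V J)"
      using g Suc D_ge[of J] by (intro add_mono mult_right_mono mult_left_mono) auto
    also have "\<dots> = prob (D J \<inter> G J) + prob (V J - G J)" by (simp add: 1 2)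
    also have "\<dots> = prob ((D J \<inter> G J) \<union> (V J - G J))"
      using ev by (intro finite_measure_Union[symmetric]) auto
    also have "\<dots> \<le> prob (V (Suc J))"
    proof (rule finite_measure_mono)
      show "D J \<inter> G J \<union> (V J - G J) \<subseteq> V (Suc J)" by (auto simp: V_def less_Suc_eq)
      show "V (Suc J) \<in> events" by (rule sets_\<F>_events[OF V_\<F>])
    qed
    finally show ?case .
  qed (simp add: V_def)
  then show ?thesis by (simp add: V_def)
qed

text \<open>
  The bounded level \<open>R\<close> can be lowered to any \<open>d > 0\<close> by a fixed number \<open>r\<close> of contraction steps.
\<close>

lemma hits_below_small:
  assumes bdd: "hits_below R"
    and "y > 1" and \<psi>: "eventually (\<lambda>e. \<psi> e y > 0) (at_right 0)" and "d > 0"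
  shows "hits_below d"
proof -
  obtain p where p: "p > 0" and R: "\<And>m F. F \<in> sets (\<F> {..<m}) \<Longrightarrow>
      \<exists>n0\<ge>m. \<forall>n\<ge>n0. prob {\<omega> \<in> F. x n \<omega> < R} \<ge> p * prob F"
    using bdd unfolding hits_below_def by blast
  obtain e0 where e0: "e0 > 0" "\<And>e. 0 < e \<Longrightarrow> e < e0 \<Longrightarrow> \<psi> e y > 0"
    using \<psi> by (auto simp: eventually_at_right_field)
  define c where "c = d * (y - 1) / y"
  have c: "c > 0" using \<open>y > 1\<close> \<open>d > 0\<close> by (simp add: c_def)
  define e where "e = min e0 c / 2"
  have e: "0 < e" "e < e0" "e < c" using e0(1) c by (auto simp: e_def)
  have "e * y / (y - 1) < d" using e(3) \<open>y > 1\<close> by (simp add: c_def field_simps)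
  then obtain r where r: "\<And>n F. F \<in> sets (\<F> {..<n}) \<Longrightarrow>
      prob {\<omega> \<in> F. x (n + r) \<omega> < d} \<ge> \<psi> e y ^ r * prob {\<omega> \<in> F. x n \<omega> < R}"
    using contraction_reaches[OF \<open>y > 1\<close> e(1), of d R] by blast
  have q: "\<psi> e y > 0" using e0(2) e by simp
  show ?thesis
    unfolding hits_below_def
  proof (rule exI[of _ "\<psi> e y ^ r * p"], intro conjI allI ballI)
    show "0 < \<psi> e y ^ r * p" using q p by simp
    fix m F assume F: "F \<in> sets (\<F> {..<m})"
    obtain n0 where n0: "n0 \<ge> m" "\<And>n. n \<ge> n0 \<Longrightarrow> prob {\<omega> \<in> F. x n \<omega> < R} \<ge> p * prob F"
      using R[OF F] by blast
    show "\<exists>n0\<ge>m. \<forall>n\<ge>n0. \<psi> e y ^ r * p * prob F \<le> prob {\<omega> \<in> F. x n \<omega> < d}"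
    proof (rule exI[of _ "n0 + r"], intro conjI allI impI)
      show "m \<le> n0 + r" using n0(1) by simp
      fix n assume n: "n0 + r \<le> n"
      define k where "k = n - r"
      have k: "n = k + r" "k \<ge> n0" using n by (auto simp: k_def)
      have "F \<in> sets (\<F> {..<k})"
        using F sets_\<F>_mono[of "{..<m}" "{..<k}"] k n0(1) by auto
      from r[OF this] have "\<psi> e y ^ r * prob {\<omega> \<in> F. x k \<omega> < R} \<le> prob {\<omega> \<in> F. x n \<omega> < d}"
        by (simp add: k)
      moreover have "\<psi> e y ^ r * (p * prob F) \<le> \<psi> e y ^ r * prob {\<omega> \<in> F. x k \<omega> < R}"
        using n0(2)[OF k(2)] q by (intro mult_left_mono) auto
      ultimately show "\<psi> e y ^ r * p * prob F \<le> prob {\<omega> \<in> F. x n \<omega> < d}"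
        by (simp add: mult.assoc)
    qed
  qed
qed

text \<open>
  Take for \<open>F\<close> the event \<open>A L\<close> that there is no hit between \<open>N\<close> and \<open>L\<close>. It decreases to the event
  \<open>B\<close> that there is no hit at all, so the probability of a hit after \<open>A L\<close>, which is that of
  \<open>A L - B\<close>, tends to 0; but it is at least \<open>p\<close> times the probability of \<open>B\<close>.
\<close>

lemma AE_infinitely_often:
  assumes E: "\<And>n. E n \<in> sets (\<F> {..<n})" and "p > 0"
    and hit: "\<And>m F. F \<in> sets (\<F> {..<m}) \<Longrightarrow> prob {\<omega> \<in> F. \<exists>n\<ge>N. \<omega> \<in> E n} \<ge> p * prob F"
  shows "AE \<omega> in M. \<exists>n\<ge>N. \<omega> \<in> E n"
proof -
  have E_ev [measurable]: "E n \<in> events" for n by (rule sets_\<F>_events[OF E])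
  define A where "A L = {\<omega> \<in> space M. \<forall>n\<in>{N..<L}. \<omega> \<notin> E n}" for L
  define B where "B = {\<omega> \<in> space M. \<forall>n\<ge>N. \<omega> \<notin> E n}"
  have A_\<F>: "A L \<in> sets (\<F> {..<L})" for L
  proof -
    have "E n \<in> sets (\<F> {..<L})" if "n < L" for n
      using E[of n] sets_\<F>_mono[of "{..<n}" "{..<L}"] that by auto
    then have "space (\<F> {..<L}) - (\<Union>n\<in>{N..<L}. E n) \<in> sets (\<F> {..<L})"
      by (intro sets.compl_sets sets.finite_UN) auto
    also have "space (\<F> {..<L}) - (\<Union>n\<in>{N..<L}. E n) = A L" by (auto simp: A_def)
    finally show ?thesis .
  qed
  have B_ev: "B \<in> events" unfolding B_def by measurable
  have A_ev: "A L \<in> events" for L by (rule sets_\<F>_events[OF A_\<F>])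
  have BA: "B \<subseteq> A L" for L by (auto simp: A_def B_def)
  have "p * prob B \<le> prob (A L) - prob B" for L
  proof -
    have "p * prob B \<le> p * prob (A L)"
      using finite_measure_mono[OF BA A_ev] \<open>p > 0\<close> by (intro mult_left_mono) auto
    also have "\<dots> \<le> prob {\<omega> \<in> A L. \<exists>n\<ge>N. \<omega> \<in> E n}" by (rule hit[OF A_\<F>])
    also have "{\<omega> \<in> A L. \<exists>n\<ge>N. \<omega> \<in> E n} = A L - B" by (auto simp: A_def B_def)
    also have "prob (A L - B) = prob (A L) - prob B"
      by (rule finite_measure_Diff[OF A_ev B_ev BA])
    finally show ?thesis .
  qed
  moreover have "(\<lambda>L. prob (A L) - prob B) \<longlonglongrightarrow> prob (\<Inter>L. A L) - prob B"
    by (intro tendsto_diff tendsto_const finite_Lim_measure_decseq)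
       (use A_ev in \<open>auto simp: A_def decseq_def\<close>)
  moreover have "(\<Inter>L. A L) = B" by (fastforce simp: A_def B_def)
  ultimately have "p * prob B \<le> 0" by (intro LIMSEQ_le_const[of _ 0]) auto
  then have "prob B = 0" using \<open>p > 0\<close> measure_nonneg[of M B] by (simp add: mult_le_0_iff)
  then have "AE \<omega> in M. \<omega> \<notin> B"
    using B_ev by (intro AE_not_in null_setsI) (simp_all add: emeasure_eq_measure)
  then show ?thesis by (rule AE_mp) (auto intro!: AE_I2 simp: B_def)
qed

text \<open>
  All descents that start between \<open>L\<close> and \<open>2 * L\<close> aim at the same level \<open>e = c * h (2 * L)\<close>, which
  is below \<open>c * h n\<close> for every time \<open>n\<close> in this window. Each of them succeeds with the same probability
  \<open>g\<close>, and \<open>g\<close> is at least \<open>2 * L\<close> to the power \<open>- \<kappa>\<close> with \<open>\<kappa> < 1\<close>. As there are about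
  \<open>L / K\<close> attempts with \<open>K = O (ln L)\<close>, the expected number of successes is at least 1 for large
  \<open>L\<close>.
\<close>

lemma AE_infinitely_often_less:
  assumes rv: "regularly_varying_at_0 \<rho> H" and "\<rho> > 0"
    and bdd: "hits_below R"
    and "y > 1" and "v > 0"
    and \<psi>: "eventually (\<lambda>e. exp (- (v * H e)) \<le> \<psi> e y) (at_right 0)"
    and c: "c > 0" "v < c powr \<rho> * (1 - y powr (-\<rho>))"
  shows "AE \<omega> in M. \<exists>n\<ge>N. x n \<omega> < c * gen_inverse H (ln (real n))"
proof -
  have cp: "c powr \<rho> > 0" using c by simp
  have "y powr (-\<rho>) < 1 - v / c powr \<rho>" using c(2) cp by (simp add: field_simps)
  \<comment> \<open>Room for the loss in the geometric series of \<open>rv_geometric_descent\<close>; similarly \<open>u\<close> below leaves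
      room for the loss in \<open>H (h n) \<approx> c powr (-\<rho>) * ln n\<close>.\<close>
  then obtain q where q: "y powr (-\<rho>) < q" "q < 1 - v / c powr \<rho>" using dense by blast
  have q1: "q < 1" using q(2) \<open>v > 0\<close> cp by (smt (verit) divide_pos_pos)
  define l where "l = v / (1 - q)"
  have l: "l > 0" using \<open>v > 0\<close> q1 by (simp add: l_def)
  have "v < (1 - q) * c powr \<rho>" using q(2) cp by (simp add: field_simps)
  then have lc: "l < c powr \<rho>" using q1 by (simp add: l_def field_simps)
  then have "c powr (-\<rho>) < 1 / l" using l cp by (simp add: powr_minus field_simps)
  then obtain u where u: "c powr (-\<rho>) < u" "u < 1 / l" using dense by blast
  have u0: "u > 0" using u(1) c(1) by (smt (verit) powr_gt_zero)
  define \<kappa> where "\<kappa> = l * u"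
  have \<kappa>: "0 < \<kappa>" "\<kappa> < 1" using u(2) l u0 by (auto simp: \<kappa>_def field_simps)
  obtain d0 where d0: "d0 > 0" and desc: "\<And>d. 0 < d \<Longrightarrow> d \<le> d0 \<Longrightarrow> (\<exists>C>0. \<forall>e. 0 < e \<and> e \<le> d \<longrightarrow>
           (\<exists>K>0. d < e * y ^ K \<and> (\<forall>k<K. e * y ^ k \<le> d) \<and>
              (\<Sum>k<K. H (e * y ^ k)) \<le> H e / (1 - q) \<and> real K \<le> 1 + C * H e))"
    using rv_geometric_descent[OF rv \<open>\<rho> > 0\<close> \<open>y > 1\<close> q(1) q1] by blast
  obtain d1 where d1: "d1 > 0" "\<And>e. 0 < e \<Longrightarrow> e < d1 \<Longrightarrow> exp (- (v * H e)) \<le> \<psi> e y"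
    using \<psi> by (auto simp: eventually_at_right_field)
  define d where "d = min d0 d1 / 2"
  have d: "0 < d" "d \<le> d0" "d < d1" using d0 d1(1) by (auto simp: d_def)
  from desc[OF d(1,2)] obtain C where C: "C > 0" "\<And>e. 0 < e \<Longrightarrow> e \<le> d \<Longrightarrow>
      \<exists>K>0. d < e * y ^ K \<and> (\<forall>k<K. e * y ^ k \<le> d) \<and>
              (\<Sum>k<K. H (e * y ^ k)) \<le> H e / (1 - q) \<and> real K \<le> 1 + C * H e" by blast
  have "eventually (\<lambda>e. \<psi> e y > 0) (at_right 0)"
    using \<psi> by (rule eventually_mono) (use exp_gt_zero less_le_trans in blast)
  from hits_below_small[OF bdd \<open>y > 1\<close> this d(1)]
  obtain p where p: "p > 0" "\<And>m F. F \<in> sets (\<F> {..<m}) \<Longrightarrow>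
      \<exists>n0\<ge>m. \<forall>n\<ge>n0. prob {\<omega> \<in> F. x n \<omega> < d} \<ge> p * prob F"
    unfolding hits_below_def by blast
  define h where "h n = c * gen_inverse H (ln (real n))" for n
  define E where "E n = {\<omega> \<in> space M. x n \<omega> < h n}" for n
  have E_\<F>: "E n \<in> sets (\<F> {..<n})" for n
  proof -
    have "space M \<in> sets (\<F> {..<n})" using sets.top[of "\<F> {..<n}"] by simp
    from level_event_\<F>[OF this order_refl] show ?thesis by (simp add: E_def)
  qed
  have "AE \<omega> in M. \<exists>n\<ge>N. \<omega> \<in> E n"
  proof (rule AE_infinitely_often[OF E_\<F>])
    show "p / 2 > 0" using p by simp
    fix m F assume F: "F \<in> sets (\<F> {..<m})"
    obtain n0 where n0: "n0 \<ge> m" "\<And>n. n \<ge> n0 \<Longrightarrow> prob {\<omega> \<in> F. x n \<omega> < d} \<ge> p * prob F"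
      using p(2)[OF F] by blast
    have dbl: "filterlim (\<lambda>L. 2 * L) sequentially (sequentially :: nat filter)"
      by (rule filterlim_subseq) (auto simp: strict_mono_def)
    have "eventually (\<lambda>n. H (h n) < u * ln (real n)) sequentially"
      unfolding h_def by (rule rv_gen_inverse_ln_less[OF rv \<open>\<rho> > 0\<close> c(1) u(1)])
    from eventually_compose_filterlim[OF this dbl]
    have 1: "eventually (\<lambda>L. H (h (2 * L)) < u * ln (real (2 * L))) sequentially" .
    have "filterlim h (at_right 0) sequentially"
      unfolding h_def by (rule rv_gen_inverse_ln_tendsto[OF rv \<open>\<rho> > 0\<close> c(1)])
    then have "eventually (\<lambda>n. 0 < h n \<and> h n \<le> d) sequentially"
      by (rule eventually_compose_filterlim[rotated])
         (use d in \<open>auto simp: eventually_at_right_field intro!: exI[of _ d]\<close>)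
    from eventually_compose_filterlim[OF this dbl]
    have 2: "eventually (\<lambda>L. 0 < h (2 * L) \<and> h (2 * L) \<le> d) sequentially" .
    have 3: "eventually (\<lambda>L. H 1 \<le> ln (real L)) sequentially" by real_asymp
    have 4: "eventually (\<lambda>L. 1 \<le> (real L / (1 + C * (u * ln (real (2 * L)))) - 1) * real (2 * L) powr (- \<kappa>)) sequentially"
      using \<kappa> C(1) u0 by real_asymp
    have 5: "eventually (\<lambda>L. L \<ge> max (max n0 N) 1) sequentially" by (rule eventually_ge_at_top)
    from 1 2 3 4 5 have "eventually (\<lambda>L. H (h (2 * L)) < u * ln (real (2 * L)) \<and>
      0 < h (2 * L) \<and> h (2 * L) \<le> d \<and> H 1 \<le> ln (real L) \<and>
      1 \<le> (real L / (1 + C * (u * ln (real (2 * L)))) - 1) * real (2 * L) powr (- \<kappa>) \<and>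
      L \<ge> max (max n0 N) 1) sequentially" by eventually_elim simp
    then obtain L where L: "H (h (2 * L)) < u * ln (real (2 * L))"
      "0 < h (2 * L)" "h (2 * L) \<le> d" "H 1 \<le> ln (real L)"
      "1 \<le> (real L / (1 + C * (u * ln (real (2 * L)))) - 1) * real (2 * L) powr (- \<kappa>)"
      "L \<ge> n0" "L \<ge> N" "L \<ge> 1"
      by (auto simp: eventually_sequentially)
    define e where "e = h (2 * L)"
    have e: "0 < e" "e \<le> d" using L by (auto simp: e_def)
    obtain K where K: "K > 0" "d < e * y ^ K" "\<And>k. k < K \<Longrightarrow> e * y ^ k \<le> d"
      "(\<Sum>k<K. H (e * y ^ k)) \<le> H e / (1 - q)" "real K \<le> 1 + C * H e"
      using C(2)[OF e] by blast
    define g where "g = (\<Prod>k<K. \<psi> (e * y ^ k) y)"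
    define s where "s j = L + j * K" for j
    define D where "D j = {\<omega> \<in> F. x (s j) \<omega> < d}" for j
    define G where "G j = descent (s j) K e y" for j
    define J where "J = L div K"
    have g_ge: "g \<ge> real (2 * L) powr (- \<kappa>)"
    proof -
      have "real (2 * L) powr (- \<kappa>) = exp (- (l * (u * ln (real (2 * L)))))"
        using L by (simp add: powr_def \<kappa>_def mult_ac)
      also have "\<dots> \<le> exp (- (l * H e))" using L(1) l by (simp add: e_def)
      also have "\<dots> = exp (- (v * (H e / (1 - q))))" by (simp add: l_def)
      also have "\<dots> \<le> exp (- (v * (\<Sum>k<K. H (e * y ^ k))))"
        using mult_left_mono[OF K(4), of v] \<open>v > 0\<close> by simp
      also have "\<dots> = (\<Prod>k<K. exp (- (v * H (e * y ^ k))))"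
        by (simp add: exp_sum sum_distrib_left flip: sum_negf)
      also have "\<dots> \<le> g"
        unfolding g_def
      proof (intro prod_mono conjI)
        fix k assume "k \<in> {..<K}"
        then have "e * y ^ k < d1" using K(3)[of k] d by simp
        then show "exp (- (v * H (e * y ^ k))) \<le> \<psi> (e * y ^ k) y"
          using e \<open>y > 1\<close> by (intro d1(2)) auto
      qed simp
      finally show ?thesis .
    qed
    have g01: "0 \<le> g" "g \<le> 1"
      unfolding g_def by (auto intro!: prod_nonneg prod_le_1 simp: \<psi>_def)
    have Jg: "1 \<le> real J * g"
    proof -
      have "real K \<le> 1 + C * (u * ln (real (2 * L)))"
        using K(5) L(1) C(1) by (smt (verit) e_def mult_left_mono)
      then have "real L / (1 + C * (u * ln (real (2 * L)))) \<le> real L / real K"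
        using K(1) by (intro divide_left_mono) auto
      also have "\<dots> \<le> real J + 1"
      proof -
        have "L \<le> (J + 1) * K"
          using div_mult_mod_eq[of L K] mod_less_divisor[of K L] K(1)
          unfolding J_def add_mult_distrib by linarith
        then have "real L \<le> real ((J + 1) * K)" by (simp only: of_nat_le_iff)
        then show ?thesis using K(1) by (simp add: pos_divide_le_eq algebra_simps)
      qed
      finally have J: "real L / (1 + C * (u * ln (real (2 * L)))) - 1 \<le> real J" by simp
      have "1 \<le> (real L / (1 + C * (u * ln (real (2 * L)))) - 1) * real (2 * L) powr (- \<kappa>)"
        by (rule L(5))
      also have "\<dots> \<le> real J * real (2 * L) powr (- \<kappa>)" using J by (rule mult_right_mono) simp
      also have "\<dots> \<le> real J * g" using g_ge by (rule mult_left_mono) simp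
      finally show ?thesis .
    qed
    have "(1 - g) ^ J \<le> exp (- g) ^ J"
      using g01 exp_ge_add_one_self[of "- g"] by (intro power_mono) auto
    also have "\<dots> = exp (- (real J * g))" by (simp flip: exp_of_nat_mult)
    also have "\<dots> \<le> exp (- 1)" using Jg by simp
    also have "\<dots> \<le> 1 / 2"
      using exp_ge_add_one_self[of 1] by (simp add: exp_minus field_simps)
    finally have half: "1 / 2 \<le> 1 - (1 - g) ^ J" by simp
    have "p / 2 * prob F = p * prob F * (1 / 2)" by simp
    also have "\<dots> \<le> p * prob F * (1 - (1 - g) ^ J)"
      using half p by (intro mult_left_mono) auto
    also have "\<dots> \<le> prob (\<Union>j<J. D j \<inter> G j)"
    proof (rule prob_some_success)
      show "mono s" by (auto simp: s_def intro!: monoI)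
      fix j
      have sj: "m \<le> s j" "n0 \<le> s j" using L(6) n0(1) by (auto simp: s_def)
      then have "F \<in> sets (\<F> {..<s j})" using F sets_\<F>_mono[of "{..<m}" "{..<s j}"] by auto
      from level_event_\<F>[OF this order_refl] show "D j \<in> sets (\<F> {..<s j})" by (simp add: D_def)
      show "p * prob F \<le> prob (D j)" unfolding D_def by (rule n0(2)[OF sj(2)])
      have "s (Suc j) = s j + K" by (simp add: s_def)
      then show "G j \<in> sets (\<F> {s j..<s (Suc j)})" by (simp add: G_def descent_\<F>)
      show "prob (G j) = g" by (simp add: G_def g_def prob_descent)
    qed
    also have "\<dots> \<le> prob {\<omega> \<in> F. \<exists>n\<ge>N. \<omega> \<in> E n}"
    proof (rule finite_measure_mono)
      have "{\<omega> \<in> F. \<exists>n\<ge>N. \<omega> \<in> E n} = F \<inter> (\<Union>n\<in>{N..}. E n)" by auto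
      also have "\<dots> \<in> events"
        using sets_\<F>_events[OF F] sets_\<F>_events[OF E_\<F>]
        by (intro sets.Int sets.countable_UN') auto
      finally show "{\<omega> \<in> F. \<exists>n\<ge>N. \<omega> \<in> E n} \<in> events" .
      show "(\<Union>j<J. D j \<inter> G j) \<subseteq> {\<omega> \<in> F. \<exists>n\<ge>N. \<omega> \<in> E n}"
      proof
        fix \<omega> assume "\<omega> \<in> (\<Union>j<J. D j \<inter> G j)"
        then obtain j where j: "j < J" and \<omega>: "\<omega> \<in> D j" "\<omega> \<in> G j" by auto
        have "x (s j) \<omega> < e * y ^ K" using \<omega>(1) K(2) by (simp add: D_def)
        then have less: "x (s j + K) \<omega> < e" using \<omega>(2) by (intro descent_reaches) (auto simp: G_def)
        have "Suc j * K \<le> J * K" using j by (intro mult_right_mono) auto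
        also have "\<dots> \<le> L" by (simp add: J_def)
        finally have n: "L \<le> s j + K" "s j + K \<le> 2 * L" by (auto simp: s_def)
        have "ln (real L) \<le> ln (real (s j + K))" "ln (real (s j + K)) \<le> ln (real (2 * L))"
          using n L(8) by (subst ln_le_cancel_iff; simp)+
        then have "h (2 * L) \<le> h (s j + K)"
          unfolding h_def using c(1) L(4) by (intro mult_left_mono gen_inverse_antimono) auto
        then have "\<omega> \<in> E (s j + K)" using less \<omega>(2) by (simp add: E_def e_def G_def descent_def)
        then show "\<omega> \<in> {\<omega> \<in> F. \<exists>n\<ge>N. \<omega> \<in> E n}"
          using n(1) L(7) \<omega>(1) by (auto simp: D_def intro!: exI[of _ "s j + K"])
      qed
    qed
    finally show "p / 2 * prob F \<le> prob {\<omega> \<in> F. \<exists>n\<ge>N. \<omega> \<in> E n}" .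
  qed
  then show ?thesis by (rule AE_mp) (auto intro!: AE_I2 simp: E_def h_def)
qed

end

section \<open>Moments, tails and the limit inferior\<close>

text \<open>
  By monotone convergence the integral of the negative part, possibly infinite, is the supremum of
  the integrals of its truncations; one of them already exceeds the integral of the positive part.
  The value \<open>-\<infinity>\<close> of the logarithm at 0 is truncated to \<open>- T\<close> like any other.
\<close>

lemma (in prob_space) truncated_log_integral_neg:
  assumes [measurable]: "A \<in> borel_measurable M"
    and neg: "ext_expectation M (\<lambda>\<omega>. elog (A \<omega>)) < 0"
  shows "\<exists>T>0. integrable M (\<lambda>\<omega>. ln (max (A \<omega>) (exp (- T)))) \<and>
           (\<integral>\<omega>. ln (max (A \<omega>) (exp (- T))) \<partial>M) < 0"
proof -
  define p where "p \<omega> = (if A \<omega> \<le> 0 then 0 else max 0 (ln (A \<omega>)))" for \<omega>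
  define m where "m i \<omega> = (if A \<omega> \<le> 0 then real (Suc i) else min (real (Suc i)) (max 0 (- ln (A \<omega>))))" for i \<omega>
  have [measurable]: "p \<in> borel_measurable M" unfolding p_def by measurable
  have [measurable]: "m i \<in> borel_measurable M" for i unfolding m_def by measurable
  have p_nonneg: "p \<omega> \<ge> 0" and m_nonneg: "m i \<omega> \<ge> 0" and m_le: "m i \<omega> \<le> real (Suc i)" for i \<omega>
    by (auto simp: p_def m_def)
  have e2p: "e2ennreal (elog (A \<omega>)) = ennreal (p \<omega>)" for \<omega>
    by (auto simp: elog_def p_def max_def ennreal_neg e2ennreal_neg simp flip: e2ennreal_ereal)
  have e2m: "e2ennreal (- elog (A \<omega>)) = (SUP i. ennreal (m i \<omega>))" for \<omega>
  proof (cases "A \<omega> \<le> 0")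
    case True
    have "(SUP i. ennreal (m i \<omega>)) = (SUP i. of_nat (Suc i))"
      using True by (simp add: m_def ennreal_of_nat_eq_real_of_nat)
    also have "\<dots> = (\<top>::ennreal)"
    proof (rule ennreal_SUP_eq_top)
      fix n :: nat show "\<exists>i\<in>UNIV. (of_nat n :: ennreal) \<le> of_nat (Suc i)"
        by (intro bexI[of _ n] of_nat_mono) auto
    qed
    finally have "(SUP i. ennreal (m i \<omega>)) = \<top>" .
    moreover have "e2ennreal (- elog (A \<omega>)) = \<top>"
      using True by (simp add: elog_def e2ennreal_infty)
    ultimately show ?thesis by (simp only:)
  next
    case False
    define v where "v = max 0 (- ln (A \<omega>))"
    have "(SUP i. ennreal (m i \<omega>)) = ennreal v"
    proof (rule antisym)
      show "(SUP i. ennreal (m i \<omega>)) \<le> ennreal v"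
        using False by (intro SUP_least ennreal_leI) (auto simp: m_def v_def)
      obtain i where "v \<le> real i" using real_arch_simple by blast
      then have "m i \<omega> = v" using False by (simp add: m_def v_def)
      then show "ennreal v \<le> (SUP i. ennreal (m i \<omega>))" by (metis SUP_upper UNIV_I)
    qed
    moreover have "e2ennreal (- elog (A \<omega>)) = ennreal v"
      using False by (cases "ln (A \<omega>) \<ge> 0") (simp_all add: elog_def v_def e2ennreal_ereal ennreal_neg)
    ultimately show ?thesis by simp
  qed
  define P where "P = (\<integral>\<^sup>+\<omega>. ennreal (p \<omega>) \<partial>M)"
  define Q where "Q = (\<integral>\<^sup>+\<omega>. (SUP i. ennreal (m i \<omega>)) \<partial>M)"
  have PQ: "enn2ereal P - enn2ereal Q < 0"
    using neg by (simp add: ext_expectation_def e2p e2m P_def Q_def)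
  have "enn2ereal P \<noteq> \<infinity>" using PQ by auto
  then have P_fin: "P \<noteq> \<top>" by (metis enn2ereal_top infinity_ereal_def)
  have "enn2ereal P < enn2ereal Q"
    using PQ \<open>enn2ereal P \<noteq> \<infinity>\<close> enn2ereal_nonneg[of P] enn2ereal_nonneg[of Q]
    by (cases "enn2ereal P"; cases "enn2ereal Q") auto
  then have "P < Q" by (simp add: less_ennreal.rep_eq)
  also have "Q = (SUP i. \<integral>\<^sup>+\<omega>. ennreal (m i \<omega>) \<partial>M)"
    unfolding Q_def
  proof (rule nn_integral_monotone_convergence_SUP)
    show "incseq (\<lambda>i \<omega>. ennreal (m i \<omega>))"
      by (intro incseq_SucI le_funI ennreal_leI) (auto simp: m_def)
  qed measurable
  finally obtain i where i: "P < (\<integral>\<^sup>+\<omega>. ennreal (m i \<omega>) \<partial>M)" by (auto simp: less_SUP_iff)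
  have int_p: "integrable M p"
    using P_fin by (intro integrableI_nonneg) (auto simp: p_nonneg P_def less_top[symmetric])
  have int_m: "integrable M (m i)"
    by (rule integrable_const_bound[of _ "real (Suc i)"]) (use m_nonneg m_le in \<open>auto intro!: AE_I2\<close>)
  have "ennreal (\<integral>\<omega>. p \<omega> \<partial>M) < ennreal (\<integral>\<omega>. m i \<omega> \<partial>M)"
    using i int_p int_m by (simp add: P_def nn_integral_eq_integral p_nonneg m_nonneg)
  then have lt: "(\<integral>\<omega>. p \<omega> \<partial>M) < (\<integral>\<omega>. m i \<omega> \<partial>M)"
    by (subst (asm) ennreal_less_iff) (auto simp: p_nonneg)
  have eq: "ln (max (A \<omega>) (exp (- real (Suc i)))) = p \<omega> - m i \<omega>" for \<omega>
  proof (cases "A \<omega> \<le> 0")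
    case True
    then have "max (A \<omega>) (exp (- real (Suc i))) = exp (- real (Suc i))"
      by (intro max_absorb2) (use exp_ge_zero order_trans in blast)
    then show ?thesis using True by (simp add: p_def m_def)
  next
    case False
    have "ln (max (A \<omega>) (exp (- real (Suc i)))) = max (ln (A \<omega>)) (- real (Suc i))"
      using False by (cases "A \<omega> \<le> exp (- real (Suc i))")
        (auto simp: max_def ln_le_cancel_iff[symmetric] not_le simp del: ln_le_cancel_iff)
    then show ?thesis using False by (auto simp: p_def m_def)
  qed
  have "integrable M (\<lambda>\<omega>. p \<omega> - m i \<omega>)" "(\<integral>\<omega>. p \<omega> - m i \<omega> \<partial>M) < 0"
    using int_p int_m lt by simp_all
  then show ?thesis by (intro exI[of _ "real (Suc i)"]) (simp only: eq of_nat_0_less_iff zero_less_Suc simp_thms)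
qed

text \<open>
  Where \<open>B\<close> vanishes, both integrands are 0: the positive part of \<open>-\<infinity>\<close>, and \<open>ln 0 = 0\<close> by
  convention.
\<close>

lemma (in prob_space) log_plus_integrable:
  assumes [measurable]: "B \<in> borel_measurable M"
    and fin: "ext_expectation M (\<lambda>\<omega>. max 0 (elog (B \<omega>))) < \<infinity>"
  shows "integrable M (\<lambda>\<omega>. max 0 (ln (max 0 (B \<omega>))))"
proof -
  have eq: "e2ennreal (max 0 (elog (B \<omega>))) = ennreal (max 0 (ln (max 0 (B \<omega>))))" for \<omega>
    by (auto simp: elog_def max_def simp flip: e2ennreal_ereal zero_ereal_def)
  have neg0: "e2ennreal (- max 0 (elog (B \<omega>))) = 0" for \<omega>
    by (rule e2ennreal_neg) simp
  have "enn2ereal (\<integral>\<^sup>+\<omega>. ennreal (max 0 (ln (max 0 (B \<omega>)))) \<partial>M) < \<infinity>"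
    using fin unfolding ext_expectation_def eq neg0
    by (simp add: zero_ennreal.rep_eq del: ennreal_max_0 ennreal_max_0')
  then have "(\<integral>\<^sup>+\<omega>. ennreal (max 0 (ln (max 0 (B \<omega>)))) \<partial>M) < \<infinity>"
    by (metis enn2ereal_top infinity_ennreal_def infinity_ereal_def less_irrefl top.not_eq_extremum)
  then show ?thesis by (intro integrableI_nonneg) auto
qed

lemma (in prob_space) indep_vars_reindex_inj:
  assumes X: "indep_vars M' X I" and f: "inj_on f J" "f ` J \<subseteq> I"
  shows "indep_vars (\<lambda>j. M' (f j)) (\<lambda>j. X (f j)) J"
proof -
  have rv: "\<And>i. i \<in> I \<Longrightarrow> random_variable (M' i) (X i)"
    and ind: "indep_sets (\<lambda>i. {X i -` A \<inter> space M |A. A \<in> sets (M' i)}) I"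
    using X by (auto simp: indep_vars_def2)
  have "indep_sets (\<lambda>j. {X (f j) -` A \<inter> space M |A. A \<in> sets (M' (f j))}) J"
  proof (rule indep_setsI)
    fix j assume "j \<in> J"
    then have "f j \<in> I" using f by auto
    from rv[OF this] show "{X (f j) -` A \<inter> space M |A. A \<in> sets (M' (f j))} \<subseteq> events"
      by (auto intro: measurable_sets)
  next
    fix A L assume L: "L \<noteq> {}" "L \<subseteq> J" "finite L"
      and A: "\<forall>j\<in>L. A j \<in> {X (f j) -` A \<inter> space M |A. A \<in> sets (M' (f j))}"
    have inj: "inj_on f L" using f(1) L(2) by (rule inj_on_subset)
    define A' where "A' = A \<circ> the_inv_into L f"
    have A': "A' (f j) = A j" if "j \<in> L" for j
      using that inj by (simp add: A'_def the_inv_into_f_f)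
    have "prob (\<Inter>i\<in>f ` L. A' i) = (\<Prod>i\<in>f ` L. prob (A' i))"
      by (rule indep_setsD[OF ind]) (use L f A A' in auto)
    then show "prob (\<Inter>j\<in>L. A j) = (\<Prod>j\<in>L. prob (A j))"
      using inj A' by (simp add: prod.reindex)
  qed
  then show ?thesis using rv f by (auto simp: indep_vars_def2)
qed

lemma liminf_eqI:
  fixes f :: "nat \<Rightarrow> real"
  assumes "L > 0"
    and lo: "\<And>k. eventually (\<lambda>n. L * (1 - 1 / (real k + 2)) \<le> f n) sequentially"
    and hi: "\<And>k N. \<exists>n\<ge>N. f n \<le> L * (1 + 1 / (real k + 2))"
  shows "liminf (\<lambda>n. ereal (f n)) = ereal L"
proof (rule antisym)
  have "(\<lambda>k. L * (1 + 1 / (real k + 2))) \<longlonglongrightarrow> L * (1 + 0)"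
    by (intro tendsto_intros) real_asymp
  then have "(\<lambda>k. ereal (L * (1 + 1 / (real k + 2)))) \<longlonglongrightarrow> ereal L" by simp
  then show "liminf (\<lambda>n. ereal (f n)) \<le> ereal L"
  proof (rule LIMSEQ_le_const)
    have "liminf (\<lambda>n. ereal (f n)) \<le> ereal (L * (1 + 1 / (real k + 2)))" for k
    proof (rule ccontr)
      assume "\<not> liminf (\<lambda>n. ereal (f n)) \<le> ereal (L * (1 + 1 / (real k + 2)))"
      then have "eventually (\<lambda>n. ereal (L * (1 + 1 / (real k + 2))) < ereal (f n)) sequentially"
        by (intro less_LiminfD) simp
      then obtain N where "\<And>n. n \<ge> N \<Longrightarrow> L * (1 + 1 / (real k + 2)) < f n"
        by (auto simp: eventually_sequentially)
      with hi[of N k] show False by fastforce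
    qed
    then show "\<exists>N. \<forall>n\<ge>N. liminf (\<lambda>n. ereal (f n)) \<le> ereal (L * (1 + 1 / (real n + 2)))" by blast
  qed
  have "(\<lambda>k. L * (1 - 1 / (real k + 2))) \<longlonglongrightarrow> L * (1 - 0)"
    by (intro tendsto_intros) real_asymp
  then have "(\<lambda>k. ereal (L * (1 - 1 / (real k + 2)))) \<longlonglongrightarrow> ereal L" by simp
  then show "ereal L \<le> liminf (\<lambda>n. ereal (f n))"
  proof (rule LIMSEQ_le_const2)
    have "ereal (L * (1 - 1 / (real k + 2))) \<le> liminf (\<lambda>n. ereal (f n))" for k
      using lo[of k] by (intro Liminf_bounded) simp
    then show "\<exists>N. \<forall>n\<ge>N. ereal (L * (1 - 1 / (real n + 2))) \<le> liminf (\<lambda>n. ereal (f n))" by blast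
  qed
qed

lemma local_dependence_upper:
  assumes ldm: "local_dependence_measure \<rho> H M A B g" and "y \<ge> 0" and u: "ereal u < g y"
  shows "eventually (\<lambda>e. measure M {\<omega> \<in> space M. e * A \<omega> * y + B \<omega> < e} \<le> exp (- (u * H e))) (at_right 0)"
proof -
  let ?P = "\<lambda>e. measure M {\<omega> \<in> space M. e * A \<omega> * y + B \<omega> < e}"
  have rv: "regularly_varying_at_0 \<rho> H" using ldm by (simp add: local_dependence_measure_def)
  have "((\<lambda>e. - elog (?P e) / ereal (H e)) \<longlongrightarrow> g y) (at_right 0)"
    using ldm \<open>y \<ge> 0\<close> by (simp add: local_dependence_measure_def)
  then have "eventually (\<lambda>e. ereal u < - elog (?P e) / ereal (H e)) (at_right 0)"
    using u by (rule order_tendstoD)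
  moreover have "eventually (\<lambda>e::real. e > 0) (at_right 0)" by (rule eventually_at_right_less)
  ultimately show ?thesis
  proof eventually_elim
    case (elim e)
    note Hpos = rv_pos[OF rv elim(2)]
    show ?case
    proof (cases "?P e \<le> 0")
      case True
      then show ?thesis by (rule order_trans) simp
    next
      case False
      then have "ereal u < ereal (- ln (?P e) / H e)" using elim(1) Hpos by (simp add: elog_def)
      then have "ln (?P e) \<le> - (u * H e)" using Hpos by (simp add: field_simps)
      then have "exp (ln (?P e)) \<le> exp (- (u * H e))" by simp
      then show ?thesis using False by (simp add: not_le)
    qed
  qed
qed

lemma local_dependence_lower:
  assumes ldm: "local_dependence_measure \<rho> H M A B g" and "y \<ge> 0" and v: "g y < ereal v"
  shows "eventually (\<lambda>e. exp (- (v * H e)) \<le> measure M {\<omega> \<in> space M. e * A \<omega> * y + B \<omega> < e}) (at_right 0)"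
proof -
  let ?P = "\<lambda>e. measure M {\<omega> \<in> space M. e * A \<omega> * y + B \<omega> < e}"
  have rv: "regularly_varying_at_0 \<rho> H" using ldm by (simp add: local_dependence_measure_def)
  have "((\<lambda>e. - elog (?P e) / ereal (H e)) \<longlongrightarrow> g y) (at_right 0)"
    using ldm \<open>y \<ge> 0\<close> by (simp add: local_dependence_measure_def)
  then have "eventually (\<lambda>e. - elog (?P e) / ereal (H e) < ereal v) (at_right 0)"
    using v by (rule order_tendstoD)
  moreover have "eventually (\<lambda>e::real. e > 0) (at_right 0)" by (rule eventually_at_right_less)
  ultimately show ?thesis
  proof eventually_elim
    case (elim e)
    note Hpos = rv_pos[OF rv elim(2)]
    have "\<not> ?P e \<le> 0"
    proof
      assume "?P e \<le> 0"
      then have "- elog (?P e) / ereal (H e) = \<infinity>" using Hpos by (simp add: elog_def)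
      with elim(1) show False by simp
    qed
    moreover from this have "ereal (- ln (?P e) / H e) < ereal v" using elim(1) Hpos by (simp add: elog_def)
    then have "- (v * H e) \<le> ln (?P e)" using Hpos by (simp add: field_simps)
    ultimately show ?case by (simp add: ln_ge_iff not_le)
  qed
qed

theorem theorem6p1:
  fixes \<rho> lam :: real and H :: "real \<Rightarrow> real" and g :: "real \<Rightarrow> ereal"
    and M :: "'a measure" and A B :: "'a \<Rightarrow> real"
    and N :: "'b measure" and As Bs X :: "nat \<Rightarrow> 'b \<Rightarrow> real"
  assumes "\<rho> > 0"
    and "regularly_varying_at_0 \<rho> H"
    and "prob_space M"
    and "A \<in> borel_measurable M" and "B \<in> borel_measurable M"
    and "AE \<omega> in M. 0 \<le> A \<omega>" and "AE \<omega> in M. 0 \<le> B \<omega>"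
    and "ext_expectation M (\<lambda>\<omega>. elog (A \<omega>)) < 0"
    and "ext_expectation M (\<lambda>\<omega>. max 0 (elog (B \<omega>))) < \<infinity>"
    and "local_dependence_measure \<rho> H M A B g"
    and "g 0 > 0"
    and "ereal lam = (INF y\<in>{1<..}. ereal (y powr \<rho> / (y powr \<rho> - 1)) * g y)"
    and "lam > 0"
    and "prob_space N"
    and "iid_copies N As Bs M A B"
    and "\<And>\<omega>. \<omega> \<in> space N \<Longrightarrow> X 0 \<omega> = 0"
    and "\<And>n \<omega>. n \<ge> 1 \<Longrightarrow> \<omega> \<in> space N \<Longrightarrow> X n \<omega> = As n \<omega> * X (n - 1) \<omega> + Bs n \<omega>"
  shows "AE \<omega> in N. liminf (\<lambda>n. ereal (X n \<omega> / gen_inverse H (ln (real n))))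
                      = ereal (lam powr (1 / \<rho>))"
proof -
  note rv = assms(2) and M = assms(3) and [measurable] = assms(4,5)
  note ldm = assms(10) and lam_eq = assms(12)
  interpret M: prob_space M by (rule M)
  interpret N: prob_space N by (rule assms(14))
  define a where "a n \<omega> = max 0 (As (Suc n) \<omega>)" for n \<omega>
  define b where "b n \<omega> = max 0 (Bs (Suc n) \<omega>)" for n \<omega>
  define pos :: "real \<times> real \<Rightarrow> real \<times> real" where "pos = (\<lambda>p. (max 0 (fst p), max 0 (snd p)))"
  have pos_meas [measurable]: "pos \<in> borel_measurable borel"
    unfolding pos_def borel_prod[symmetric] by measurable
  have indep: "N.indep_vars (\<lambda>_. borel) (\<lambda>n \<omega>. (As n \<omega>, Bs n \<omega>)) {1..}"
    and law: "\<And>n. n \<ge> 1 \<Longrightarrow> distr N borel (\<lambda>\<omega>. (As n \<omega>, Bs n \<omega>)) = distr M borel (\<lambda>\<omega>. (A \<omega>, B \<omega>))"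
    using assms(15) by (auto simp: iid_copies_def)
  have AB_meas [measurable]: "(\<lambda>\<omega>. (A \<omega>, B \<omega>)) \<in> borel_measurable M"
    unfolding borel_prod[symmetric] by measurable
  have ABs_meas: "(\<lambda>\<omega>. (As n \<omega>, Bs n \<omega>)) \<in> borel_measurable N" if "n \<ge> 1" for n
    using indep that by (auto simp: N.indep_vars_def)
  have law_ab: "distr N borel (\<lambda>\<omega>. f (a n \<omega>, b n \<omega>)) = distr M borel (\<lambda>\<omega>. f (max 0 (A \<omega>), max 0 (B \<omega>)))"
    if [measurable]: "f \<in> borel_measurable borel" for f :: "real \<times> real \<Rightarrow> 'c::topological_space" and n
  proof -
    have f_pos: "f \<circ> pos \<in> borel_measurable borel" by (rule measurable_comp) measurable
    have "distr N borel (\<lambda>\<omega>. f (a n \<omega>, b n \<omega>)) = distr (distr N borel (\<lambda>\<omega>. (As (Suc n) \<omega>, Bs (Suc n) \<omega>))) borel (f \<circ> pos)"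
      by (simp add: distr_distr[OF f_pos ABs_meas]) (simp add: comp_def pos_def a_def b_def)
    also have "\<dots> = distr M borel (\<lambda>\<omega>. f (max 0 (A \<omega>), max 0 (B \<omega>)))"
      by (simp add: law distr_distr[OF f_pos AB_meas]) (simp add: comp_def pos_def)
    finally show ?thesis .
  qed
  interpret random_affine_recursion N a b
  proof
    have "N.indep_vars (\<lambda>_. borel) (\<lambda>n \<omega>. (As (Suc n) \<omega>, Bs (Suc n) \<omega>)) UNIV"
      using N.indep_vars_reindex_inj[OF indep, of Suc UNIV] by auto
    from N.indep_vars_compose2[OF this, of "\<lambda>_. pos" "\<lambda>_. borel"] pos_meas
    have "N.indep_vars (\<lambda>_. borel) (\<lambda>n \<omega>. pos (As (Suc n) \<omega>, Bs (Suc n) \<omega>)) UNIV" by simp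
    then show "N.indep_vars (\<lambda>_. borel) (\<lambda>n \<omega>. (a n \<omega>, b n \<omega>)) UNIV"
      by (simp add: pos_def a_def b_def)
    show "distr N borel (\<lambda>\<omega>. (a n \<omega>, b n \<omega>)) = distr N borel (\<lambda>\<omega>. (a 0 \<omega>, b 0 \<omega>))" for n
      using law_ab[of "\<lambda>p. p" n] law_ab[of "\<lambda>p. p" 0] by simp
  qed (simp_all add: a_def b_def)
  \<comment> \<open>The given recursion agrees with the nonnegative one almost surely.\<close>
  have "AE \<omega> in N. 0 \<le> As n \<omega> \<and> 0 \<le> Bs n \<omega>" if "n \<ge> 1" for n
  proof -
    have sets: "{p \<in> space borel. 0 \<le> fst p \<and> 0 \<le> snd p} \<in> sets (borel :: (real \<times> real) measure)"
      unfolding borel_prod[symmetric] by measurable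
    have "AE \<omega> in M. 0 \<le> A \<omega> \<and> 0 \<le> B \<omega>" using assms(6,7) by eventually_elim simp
    then have "AE p in distr M borel (\<lambda>\<omega>. (A \<omega>, B \<omega>)). 0 \<le> fst p \<and> 0 \<le> snd p"
      by (subst AE_distr_iff[OF AB_meas sets]) simp
    then have "AE p in distr N borel (\<lambda>\<omega>. (As n \<omega>, Bs n \<omega>)). 0 \<le> fst p \<and> 0 \<le> snd p"
      by (simp only: law[OF that])
    then show ?thesis by (subst (asm) AE_distr_iff[OF ABs_meas[OF that] sets]) simp
  qed
  then have "AE \<omega> in N. \<forall>n. n \<ge> 1 \<longrightarrow> 0 \<le> As n \<omega> \<and> 0 \<le> Bs n \<omega>"
    by (subst AE_all_countable) auto
  then have x_eq: "AE \<omega> in N. \<forall>n. X n \<omega> = x n \<omega>"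
  proof (rule AE_mp, intro AE_I2 impI allI)
    fix \<omega> n assume \<omega>: "\<omega> \<in> space N" "\<forall>n. n \<ge> 1 \<longrightarrow> 0 \<le> As n \<omega> \<and> 0 \<le> Bs n \<omega>"
    show "X n \<omega> = x n \<omega>"
    proof (induction n)
      case 0
      show ?case using assms(16) \<omega>(1) by simp
    next
      case (Suc n)
      have "a n \<omega> = As (Suc n) \<omega>" "b n \<omega> = Bs (Suc n) \<omega>"
        using \<omega>(2)[rule_format, of "Suc n"] by (simp_all add: a_def b_def)
      then show ?case using assms(17)[of "Suc n" \<omega>] \<omega>(1) Suc by simp
    qed
  qed
  have \<psi>_eq: "\<psi> e y = measure M {\<omega> \<in> space M. e * A \<omega> * y + B \<omega> < e}" for e y
  proof -
    have [measurable]: "Measurable.pred borel (\<lambda>p :: real \<times> real. e * fst p * y + snd p < e)"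
      unfolding borel_prod[symmetric] by measurable
    have sets: "{p. e * fst p * y + snd p < e} \<in> sets (borel :: (real \<times> real) measure)"
      using \<open>Measurable.pred borel _\<close> by (simp add: pred_def)
    have pair: "(\<lambda>\<omega>. (max 0 (A \<omega>), max 0 (B \<omega>))) \<in> borel_measurable M"
      unfolding borel_prod[symmetric] by measurable
    have "\<psi> e y = measure (distr N borel (\<lambda>\<omega>. (a 0 \<omega>, b 0 \<omega>))) {p. e * fst p * y + snd p < e}"
      by (subst measure_distr[OF pair_measurable sets])
         (auto simp: \<psi>_def step_event_def intro!: arg_cong[where f = N.prob])
    also have "\<dots> = measure M {\<omega> \<in> space M. e * max 0 (A \<omega>) * y + max 0 (B \<omega>) < e}"
      using law_ab[of "\<lambda>p. p" 0]
      by (simp add: measure_distr[OF pair sets] vimage_def Int_def conj_commute)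
    also have "\<dots> = measure M {\<omega> \<in> space M. e * A \<omega> * y + B \<omega> < e}"
    proof (rule measure_eq_AE)
      show "AE \<omega> in M. (\<omega> \<in> {\<omega> \<in> space M. e * max 0 (A \<omega>) * y + max 0 (B \<omega>) < e}) =
          (\<omega> \<in> {\<omega> \<in> space M. e * A \<omega> * y + B \<omega> < e})"
        using assms(6,7) by eventually_elim (simp add: max_def)
    qed measurable
    finally show ?thesis .
  qed
  \<comment> \<open>The lower bound. As \<open>g 0\<close> may be infinite, \<open>gam\<close> is cut off at \<open>lam\<close>.\<close>
  define gam where "gam = real_of_ereal (min (g 0) (ereal lam))"
  have gam_eq: "ereal gam = min (g 0) (ereal lam)"
    using assms(11) by (cases "g 0") (auto simp: gam_def min_def)
  have "0 < ereal gam" "ereal gam \<le> ereal lam" "ereal gam \<le> g 0"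
    using assms(11,13) unfolding gam_eq by auto
  then have gam: "0 < gam" "gam \<le> lam" "ereal gam \<le> g 0" by auto
  have \<psi>0: "eventually (\<lambda>e. \<psi> e 0 \<le> exp (- (u * H e))) (at_right 0)" if "u < gam" for u
    unfolding \<psi>_eq using that gam(3)
    by (intro local_dependence_upper[OF ldm]) (auto intro: less_le_trans[of _ "ereal gam"])
  have \<psi>1: "eventually (\<lambda>e. \<psi> e t \<le> exp (- (u * H e))) (at_right 0)"
    if t: "t \<ge> 1" and u: "u < lam * (1 - t powr (-\<rho>))" for t u
  proof (cases "t = 1")
    case True
    then have "u < 0" using u by simp
    have "eventually (\<lambda>e::real. e > 0) (at_right 0)" by (rule eventually_at_right_less)
    then show ?thesis
    proof eventually_elim
      case (elim e)
      have "\<psi> e t \<le> 1" by (simp add: \<psi>_def)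
      also have "1 \<le> exp (- (u * H e))"
        using \<open>u < 0\<close> rv_pos[OF rv elim] by (simp add: mult_neg_pos less_imp_le)
      finally show ?case .
    qed
  next
    case False
    then have t1: "t > 1" using t by simp
    then have tp: "t powr \<rho> > 1" using assms(1) by (simp add: gr_one_powr)
    have "ereal lam \<le> ereal (t powr \<rho> / (t powr \<rho> - 1)) * g t"
      unfolding lam_eq by (rule INF_lower) (use t1 in simp)
    moreover have "0 \<le> g t" using ldm t by (simp add: local_dependence_measure_def)
    moreover have "lam * (1 - t powr (-\<rho>)) \<le> r" if "lam \<le> t powr \<rho> / (t powr \<rho> - 1) * r" for r
    proof -
      have "lam * ((t powr \<rho> - 1) / t powr \<rho>) \<le> t powr \<rho> / (t powr \<rho> - 1) * r * ((t powr \<rho> - 1) / t powr \<rho>)"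
        using that tp by (intro mult_right_mono) auto
      also have "\<dots> = r" using tp t1 assms(1) by simp
      also have "(t powr \<rho> - 1) / t powr \<rho> = 1 - t powr (-\<rho>)"
        using tp t1 by (simp add: powr_minus field_simps)
      finally show ?thesis .
    qed
    ultimately have "ereal (lam * (1 - t powr (-\<rho>))) \<le> g t" by (cases "g t") auto
    then show ?thesis
      unfolding \<psi>_eq using t u by (intro local_dependence_upper[OF ldm]) (auto intro: less_le_trans[of _ "ereal _"])
  qed
  note lower = AE_eventually_ge[OF rv assms(1) gam(1,2) \<psi>0 \<psi>1]
  \<comment> \<open>The upper bound. The moment conditions are passed from \<open>A\<close>, \<open>B\<close> to the sequence through
      equality of distributions.\<close>
  obtain T where T: "T > 0" "integrable M (\<lambda>\<omega>. ln (max (A \<omega>) (exp (- T))))"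
      "(\<integral>\<omega>. ln (max (A \<omega>) (exp (- T))) \<partial>M) < 0"
    using M.truncated_log_integral_neg[OF assms(4,8)] by blast
  have max_eq: "max (max 0 (A \<omega>)) (exp (- T)) = max (A \<omega>) (exp (- T))" for \<omega>
    by (simp add: max_def) (smt (verit) exp_gt_zero)
  have f_meas: "(\<lambda>p. ln (max (fst p) (exp (- T)))) \<in> borel_measurable (borel :: (real \<times> real) measure)"
    "(\<lambda>p. max 0 (ln (snd p))) \<in> borel_measurable (borel :: (real \<times> real) measure)"
    unfolding borel_prod[symmetric] by measurable
  have law_a: "distr N borel (\<lambda>\<omega>. ln (max (a 0 \<omega>) (exp (- T)))) = distr M borel (\<lambda>\<omega>. ln (max (A \<omega>) (exp (- T))))"
    using law_ab[OF f_meas(1), of 0] by (simp add: max_eq)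
  have law_b: "distr N borel (\<lambda>\<omega>. max 0 (ln (b 0 \<omega>))) = distr M borel (\<lambda>\<omega>. max 0 (ln (max 0 (B \<omega>))))"
    using law_ab[OF f_meas(2), of 0] by simp
  have int_a: "integrable N (\<lambda>\<omega>. ln (max (a 0 \<omega>) (exp (- T))))"
  proof -
    have "integrable (distr M borel (\<lambda>\<omega>. ln (max (A \<omega>) (exp (- T))))) (\<lambda>r. r)"
      using T(2) by (subst integrable_distr_eq) auto
    then show ?thesis unfolding law_a[symmetric] by (subst (asm) integrable_distr_eq) auto
  qed
  have int_b: "integrable N (\<lambda>\<omega>. max 0 (ln (b 0 \<omega>)))"
  proof -
    have "integrable (distr M borel (\<lambda>\<omega>. max 0 (ln (max 0 (B \<omega>))))) (\<lambda>r. r)"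
      using M.log_plus_integrable[OF assms(5,9)] by (subst integrable_distr_eq) auto
    then show ?thesis unfolding law_b[symmetric] by (subst (asm) integrable_distr_eq) auto
  qed
  have drift: "(\<integral>\<omega>. ln (max (a 0 \<omega>) (exp (- T))) \<partial>N) < 0"
  proof -
    have "(\<integral>\<omega>. ln (max (a 0 \<omega>) (exp (- T))) \<partial>N) = (\<integral>r. r \<partial>distr N borel (\<lambda>\<omega>. ln (max (a 0 \<omega>) (exp (- T)))))"
      by (subst integral_distr) auto
    also have "\<dots> = (\<integral>\<omega>. ln (max (A \<omega>) (exp (- T))) \<partial>M)"
      unfolding law_a by (subst integral_distr) auto
    finally show ?thesis using T(3) by simp
  qed
  obtain R where bdd: "hits_below R"
    using negative_drift_hits_below[OF T(1) int_a drift int_b] by blast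
  have upper: "AE \<omega> in N. \<exists>n\<ge>n0. x n \<omega> < c * gen_inverse H (ln (real n))"
    if c: "c > 0" "lam < c powr \<rho>" for c n0
  proof -
    have "(INF y\<in>{1<..}. ereal (y powr \<rho> / (y powr \<rho> - 1)) * g y) < ereal (c powr \<rho>)"
      using c unfolding lam_eq[symmetric] by simp
    then obtain y where y: "y > 1" "ereal (y powr \<rho> / (y powr \<rho> - 1)) * g y < ereal (c powr \<rho>)"
      by (auto simp: INF_less_iff)
    have yp: "y powr \<rho> > 1" using y(1) assms(1) by (simp add: gr_one_powr)
    have "0 \<le> g y" using ldm y(1) by (simp add: local_dependence_measure_def)
    moreover have "g y \<noteq> \<infinity>"
    proof
      assume inf: "g y = \<infinity>"
      have times_inf: "ereal k * \<infinity> = \<infinity>" if "k > 0" for k using that by simp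
      have "ereal (y powr \<rho> / (y powr \<rho> - 1)) * g y = \<infinity>"
        unfolding inf using yp by (intro times_inf divide_pos_pos) auto
      then have "\<infinity> < ereal (c powr \<rho>)" using y(2) by (simp only:)
      then show False by simp
    qed
    ultimately obtain r where r: "g y = ereal r" "r \<ge> 0" by (cases "g y") auto
    have "y powr \<rho> / (y powr \<rho> - 1) * r < c powr \<rho>" using y(2) by (simp add: r)
    then have "r < c powr \<rho> * (1 - y powr (-\<rho>))"
    proof -
      have "r = y powr \<rho> / (y powr \<rho> - 1) * r * ((y powr \<rho> - 1) / y powr \<rho>)"
        using yp y(1) assms(1) by simp
      also have "\<dots> < c powr \<rho> * ((y powr \<rho> - 1) / y powr \<rho>)"
        using \<open>y powr \<rho> / (y powr \<rho> - 1) * r < c powr \<rho>\<close> yp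
        by (intro mult_strict_right_mono divide_pos_pos) auto
      also have "(y powr \<rho> - 1) / y powr \<rho> = 1 - y powr (-\<rho>)"
        using yp y(1) by (simp add: powr_minus field_simps)
      finally show ?thesis .
    qed
    then obtain v where v: "r < v" "v < c powr \<rho> * (1 - y powr (-\<rho>))" using dense by blast
    have "eventually (\<lambda>e. exp (- (v * H e)) \<le> \<psi> e y) (at_right 0)"
      unfolding \<psi>_eq using y(1) v(1) by (intro local_dependence_lower[OF ldm]) (auto simp: r)
    then show ?thesis
      using r v y(1) c by (intro AE_infinitely_often_less[OF rv assms(1) bdd]) auto
  qed
  \<comment> \<open>Countably many constants on either side of \<open>L\<close> suffice.\<close>
  define L where "L = lam powr (1 / \<rho>)"
  have L: "L > 0" "L powr \<rho> = lam" using assms(1,13) by (auto simp: L_def powr_powr)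
  have "AE \<omega> in N. \<forall>k. eventually (\<lambda>n. L * (1 - 1 / (real k + 2)) * gen_inverse H (ln (real n)) \<le> x n \<omega>) sequentially"
  proof (subst AE_all_countable, intro allI lower)
    fix k
    show "0 < L * (1 - 1 / (real k + 2))" using L by simp
    have "(L * (1 - 1 / (real k + 2))) powr \<rho> < L powr \<rho>"
      using L assms(1) by (intro powr_less_mono2) (auto simp: field_simps)
    then show "(L * (1 - 1 / (real k + 2))) powr \<rho> < lam" by (simp add: L)
  qed
  moreover have "AE \<omega> in N. \<forall>k n0. \<exists>n\<ge>n0. x n \<omega> < L * (1 + 1 / (real k + 2)) * gen_inverse H (ln (real n))"
    unfolding AE_all_countable
  proof (intro allI upper)
    fix k :: nat
    show "0 < L * (1 + 1 / (real k + 2))" using L by (intro mult_pos_pos add_pos_pos) auto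
    have "L powr \<rho> < (L * (1 + 1 / (real k + 2))) powr \<rho>"
      using L assms(1) by (intro powr_less_mono2) (auto simp: field_simps)
    then show "lam < (L * (1 + 1 / (real k + 2))) powr \<rho>" by (simp add: L)
  qed
  ultimately show ?thesis using x_eq
  proof eventually_elim
    case (elim \<omega>)
    let ?h = "\<lambda>n. gen_inverse H (ln (real n))"
    have "eventually (\<lambda>n. H 1 \<le> ln (real n)) sequentially" by real_asymp
    then obtain n1 where n1: "\<And>n. n \<ge> n1 \<Longrightarrow> ?h n > 0"
      using gen_inverse_rv(1)[OF rv assms(1)] by (auto simp: eventually_sequentially)
    show ?case unfolding L_def[symmetric]
    proof (rule liminf_eqI[OF L(1)])
      fix k
      have "eventually (\<lambda>n. n \<ge> n1) sequentially" by (rule eventually_ge_at_top)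
      with elim(1)[rule_format, of k]
      show "eventually (\<lambda>n. L * (1 - 1 / (real k + 2)) \<le> X n \<omega> / ?h n) sequentially"
        by eventually_elim (simp add: elim(3) n1 pos_le_divide_eq)
      fix n0
      obtain n where n: "n \<ge> max n0 n1" "x n \<omega> < L * (1 + 1 / (real k + 2)) * ?h n"
        using elim(2) by blast
      then show "\<exists>n\<ge>n0. X n \<omega> / ?h n \<le> L * (1 + 1 / (real k + 2))"
        using n1[of n] by (intro exI[of _ n]) (simp add: elim(3) pos_divide_le_eq)
    qed
  qed
qed

end
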